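(* Let $\boldsymbol{g}=(g_1,\ldots,g_m)$, $\mathbf{h}=(h_1,\ldots,h_k)$ and $F=(f_1,\ldots,f_n)$ be polynomials in $\mathbb{Q}[x_1,\ldots,x_n]$, and let $E$ be the vector space spanned by $\boldsymbol{g}$. On input a sequence $\mathbf{a}=(a_1,\ldots,a_n)$ in $\mathbb{Q}^n$, along with $\boldsymbol{g}$, $\mathbf{h}$ and $F$, the algorithm $\mathsf{TruncatedIdeal}$ (described in the context) outputs a sequence of polynomials that forms a vector basis for $I_{\mathcal{L}(\mathbf{a},\mathbf{h},F),E}$.
   Context: Notation: $\mathbf{x}=(x_1,\ldots,x_n)$. A tuple $F=(f_1,\ldots,f_n)$ of polynomials is identified with the polynomial map it defines; $F^0=\mathrm{id}$, $F^j=F\circ F^{j-1}$. Polynomial loop: $\mathcal{L}(\mathbf{a},\mathbf{h},F)$ is the loop which initializes $\mathbf{x}=\mathbf{a}$ and, while $h_1(\mathbf{x})\neq0,\ldots,h_k(\mathbf{x})\neq 0$, performs $\mathbf{x}\leftarrow F(\mathbf{x})$. A polynomial $g\in\mathbb{C}[\mathbf{x}]$ is a polynomial invariant of the loop if $g=0$ holds before and after each iteration, i.e. $g(F^l(\mathbf{a}))=0$ for every $l\ge 0$ such that $h_i(F^j(\mathbf{a}))\neq0$ for all $i$ and all $0\le j<l$. $I_{\mathcal{L}(\mathbf{a},\mathbf{h},F),E}$ is the vector space of polynomial invariants of the loop lying in $E$. Algorithm $\mathsf{InvariantSet}$, on input a sequence $\boldsymbol{p}$ of polynomials and a polynomial map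 $G$ over $\mathbb{Q}$: set $S\leftarrow\{\boldsymbol{p}\}$ and $\widetilde{\boldsymbol{p}}\leftarrow\boldsymbol{p}\circ G$; while not all entries of $\widetilde{\boldsymbol{p}}$ belong to the radical of $\langle S\rangle$, set $S\leftarrow S\cup\{\widetilde{\boldsymbol{p}}\}$ and $\widetilde{\boldsymbol{p}}\leftarrow\widetilde{\boldsymbol{p}}\circ G$; return $S$. Algorithm $\mathsf{CheckPI}$, on input $\mathbf{a}$, a polynomial $P$, $\mathbf{h}$ and $F$: with $h=h_1\cdots h_k$ and a new variable $z$, compute the output of $\mathsf{InvariantSet}(zP,(F(\mathbf{x}),z\,h(\mathbf{x})))$; return True if all output polynomials vanish at $(\mathbf{a},1)$ and False otherwise. Algorithm $\mathsf{ComputeMatrix}$, on input $(\boldsymbol{g},\mathbf{h},F)$ with $\boldsymbol{g}=(g_1,\ldots,g_m)$: with new variables $\mathbf{y}=(y_1,\ldots,y_m)$, $z$, and $h=h_1\cdots h_k$, compute the output $P_1,P_2,\ldots$ of $\mathsf{InvariantSet}(z(y_1g_1+\cdots+y_mg_m),(F(\mathbf{x}),\mathbf{y},z\,h(\mathbf{x})))$; return the matrix $A$ over $\mathbb{Q}[\mathbf{x}]$ with $[P_1(\mathbf{x},\mathbf{y},1),P_2(\mathbf{x},\mathbf{y},1),\ldots]^t=A\cdot[y_1,\ldots,y_m]^t$. $\mathsf{VectorBasis}$ takes linear forms (or a matrix) and returns a vector basis of their common zero set (of the right kernel). Algorithm $\mathsf{TruncatedIdeal}$, on input $\mathbf{a},\boldsymbol{g},\mathbf{h},F$: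 (1) set $g\leftarrow z\,(y_1g_1+\cdots+y_mg_m)$, $h\leftarrow h_1\cdots h_k$, $F_m\leftarrow(F(\mathbf{x}),\mathbf{y},z\,h(\mathbf{x}))$; (2) $(\mathbf{b}^1,\ldots,\mathbf{b}^s)\leftarrow\mathsf{VectorBasis}\big(g(\mathbf{a},\mathbf{y},1),\,g(F_m(\mathbf{a},\mathbf{y},1)),\ldots,g(F_m^m(\mathbf{a},\mathbf{y},1))\big)$, these being linear forms in $\mathbf{y}$; (3) $\mathcal{B}\leftarrow\big(\sum_i b^1_ig_i,\ldots,\sum_i b^s_ig_i\big)$; (4) let $\mathcal{B}'=(P_1,\ldots,P_l)$ be the elements $P$ of $\mathcal{B}$ for which $\mathsf{CheckPI}(\mathbf{a},P,\mathbf{h},F)$ is False; (5) if $\mathcal{B}'$ is empty, return $\mathcal{B}$; (6) otherwise $A\leftarrow\mathsf{ComputeMatrix}(\mathcal{B}',\mathbf{h},F)$, $(\mathbf{c}^1,\ldots,\mathbf{c}^t)\leftarrow\mathsf{VectorBasis}(A(\mathbf{a}))$, $\mathcal{C}\leftarrow\big(\sum_{j=1}^l c^1_jP_j,\ldots,\sum_{j=1}^l c^t_jP_j\big)$, $\mathcal{B}''\leftarrow\mathcal{B}$ with the elements of $\mathcal{B}'$ removed; return the concatenation of $\mathcal{C}$ and $\mathcal{B}''$.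
   Formalization: The output is shown to be a vector basis only when g is linearly independent; for dependent g (e.g. g=(0), where the algorithm outputs (0)) the claim fails, and only termination and that the output spans the space of invariants are stated. *)

theory Defs
  imports
    Complex_Main
    "HOL-Library.Poly_Mapping"
    "HOL-Library.While_Combinator"
    "Jordan_Normal_Form.Matrix_Kernel"
begin

section \<open>Multivariate polynomials\<close>

text \<open>Polynomials with variables indexed by \<open>'v\<close> and coefficients in \<open>'a\<close>, as finitely supported
  maps from exponent vectors; the ring structure is the convolution product of
  \<^theory>\<open>HOL-Library.Poly_Mapping\<close>.\<close>

type_synonym ('v, 'a) mpoly = "('v \<Rightarrow>\<^sub>0 nat) \<Rightarrow>\<^sub>0 'a"

definition Const :: "'a::zero \<Rightarrow> ('v, 'a) mpoly" where
  "Const c = Poly_Mapping.single 0 c"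

definition Var :: "'v \<Rightarrow> ('v, 'a::zero_neq_one) mpoly" where
  "Var v = Poly_Mapping.single (Poly_Mapping.single v 1) 1"

definition eval_via ::
    "('a::zero \<Rightarrow> 'b::comm_semiring_1) \<Rightarrow> ('v \<Rightarrow> 'b) \<Rightarrow> ('v, 'a) mpoly \<Rightarrow> 'b" where
  "eval_via \<phi> x p =
    (\<Sum>m\<in>Poly_Mapping.keys p.
       \<phi> (Poly_Mapping.lookup p m) *
       (\<Prod>v\<in>Poly_Mapping.keys m. x v ^ Poly_Mapping.lookup m v))"

definition eval :: "('v \<Rightarrow> 'a::comm_ring_1) \<Rightarrow> ('v, 'a) mpoly \<Rightarrow> 'a" where
  "eval = eval_via (\<lambda>c. c)"

definition subst ::
    "('v \<Rightarrow> ('w, 'a::comm_ring_1) mpoly) \<Rightarrow> ('v, 'a) mpoly \<Rightarrow> ('w, 'a) mpoly" where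
  "subst = eval_via Const"

definition poly_map :: "('n \<Rightarrow> ('n, 'a::comm_ring_1) mpoly) \<Rightarrow> ('n \<Rightarrow> 'a) \<Rightarrow> 'n \<Rightarrow> 'a" where
  "poly_map F x = (\<lambda>i. eval x (F i))"

definition to_complex :: "('v, rat) mpoly \<Rightarrow> ('v, complex) mpoly" where
  "to_complex = Poly_Mapping.map of_rat"

definition ideal_gen :: "('v, 'a::comm_ring_1) mpoly set \<Rightarrow> ('v, 'a) mpoly set" where
  "ideal_gen = Modules.module.span (*)"

definition radical :: "('v, 'a::comm_ring_1) mpoly set \<Rightarrow> ('v, 'a) mpoly set" where
  "radical I = {p. \<exists>k. p ^ k \<in> I}"


section \<open>Vector spaces of complex polynomials\<close>

text \<open>Polynomial invariants have complex coefficients, so spans and bases are taken over \<open>\<complex>\<close>; rational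
  polynomials enter through \<open>to_complex\<close>. Bases are lists, so independence excludes repetitions.\<close>

definition mpoly_scale :: "complex \<Rightarrow> ('v, complex) mpoly \<Rightarrow> ('v, complex) mpoly" where
  "mpoly_scale c p = Const c * p"

definition mpoly_span :: "('v, complex) mpoly set \<Rightarrow> ('v, complex) mpoly set" where
  "mpoly_span = Modules.module.span mpoly_scale"

definition mpoly_independent :: "('v, complex) mpoly list \<Rightarrow> bool" where
  "mpoly_independent ps \<longleftrightarrow> distinct ps \<and> \<not> Modules.module.dependent mpoly_scale (set ps)"

definition mpoly_basis :: "('v, complex) mpoly list \<Rightarrow> ('v, complex) mpoly set \<Rightarrow> bool" where
  "mpoly_basis ps V \<longleftrightarrow> mpoly_independent ps \<and> mpoly_span (set ps) = V"


section \<open>Polynomial loops and their invariants\<close>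

definition loop_invariant ::
    "('n \<Rightarrow> complex) \<Rightarrow> ('n, complex) mpoly list \<Rightarrow> ('n \<Rightarrow> ('n, complex) mpoly) \<Rightarrow>
     ('n, complex) mpoly \<Rightarrow> bool" where
  "loop_invariant a hs F g \<longleftrightarrow>
    (\<forall>l. (\<forall>j<l. \<forall>h\<in>set hs. eval ((poly_map F ^^ j) a) h \<noteq> 0) \<longrightarrow>
         eval ((poly_map F ^^ l) a) g = 0)"

definition invariants_in ::
    "('n \<Rightarrow> complex) \<Rightarrow> ('n, complex) mpoly list \<Rightarrow> ('n \<Rightarrow> ('n, complex) mpoly) \<Rightarrow>
     ('n, complex) mpoly set \<Rightarrow> ('n, complex) mpoly set" where
  "invariants_in a hs F E = {g \<in> E. loop_invariant a hs F g}"


section \<open>The algorithms\<close>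

text \<open>A result \<open>None\<close> stands for non-termination. In \<open>invariant_set\<close> the set \<open>S\<close> is kept as a list,
  in the order in which its elements are found, since \<open>compute_matrix\<close> needs a sequence.\<close>

definition invariant_set ::
    "('v, rat) mpoly list \<Rightarrow> ('v \<Rightarrow> ('v, rat) mpoly) \<Rightarrow> ('v, rat) mpoly list list option" where
  "invariant_set ps G = map_option fst
    (while_option
      (\<lambda>(S, qs). \<not> set qs \<subseteq> radical (ideal_gen (\<Union>ps\<in>set S. set ps)))
      (\<lambda>(S, qs). (S @ [qs], map (subst G) qs))
      ([ps], map (subst G) ps))"

text \<open>In \<open>check_pi\<close> the ring \<open>\<rat>[x, z]\<close> has variables of type \<open>'n option\<close>:
  \<open>Some i\<close> is \<open>x\<^sub>i\<close> and \<open>None\<close> is \<open>z\<close>.\<close>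

definition check_pi ::
    "('n \<Rightarrow> rat) \<Rightarrow> ('n, rat) mpoly \<Rightarrow> ('n, rat) mpoly list \<Rightarrow> ('n \<Rightarrow> ('n, rat) mpoly) \<Rightarrow>
     bool option" where
  "check_pi a P hs F =
    (let lift = subst (\<lambda>i. Var (Some i));
         h = prod_list hs;
         G = case_option (Var None * lift h) (\<lambda>i. lift (F i))
     in map_option (\<lambda>S. \<forall>q\<in>set (concat S). eval (case_option 1 a) q = 0)
          (invariant_set [Var None * lift P] G))"

text \<open>The ring \<open>\<rat>[x, y, z]\<close>. The \<open>y\<close>-variables are numbered from 0, and all of \<open>\<nat>\<close> is available as
  their index set because their number depends on the input; on input
  \<open>g\<^sub>0, \<dots>, g\<^sub>m\<^sub>-\<^sub>1\<close> only those with index below \<open>m\<close> occur in the polynomials below.\<close>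

datatype 'n xyz = X_var 'n | Y_var nat | Z_var

definition lift_x :: "('n, rat) mpoly \<Rightarrow> ('n xyz, rat) mpoly" where
  "lift_x = subst (\<lambda>i. Var (X_var i))"

definition generic_comb :: "('n, rat) mpoly list \<Rightarrow> ('n xyz, rat) mpoly" where
  "generic_comb gs = Var Z_var * (\<Sum>j<length gs. Var (Y_var j) * lift_x (gs ! j))"

definition ext_map ::
    "('n, rat) mpoly list \<Rightarrow> ('n \<Rightarrow> ('n, rat) mpoly) \<Rightarrow> 'n xyz \<Rightarrow> ('n xyz, rat) mpoly" where
  "ext_map hs F v =
    (case v of X_var i \<Rightarrow> lift_x (F i)
             | Y_var j \<Rightarrow> Var (Y_var j)
             | Z_var \<Rightarrow> Var Z_var * lift_x (prod_list hs))"

definition set_z_1 :: "('n xyz, rat) mpoly \<Rightarrow> ('n xyz, rat) mpoly" where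
  "set_z_1 = subst (\<lambda>v. case v of Z_var \<Rightarrow> 1 | _ \<Rightarrow> Var v)"

definition compute_matrix ::
    "('n, rat) mpoly list \<Rightarrow> ('n, rat) mpoly list \<Rightarrow> ('n \<Rightarrow> ('n, rat) mpoly) \<Rightarrow>
     ('n, rat) mpoly mat option" where
  "compute_matrix gs hs F = map_option
    (\<lambda>S. let Ps = concat S in
      THE A. A \<in> carrier_mat (length Ps) (length gs) \<and>
        (\<forall>i<length Ps. set_z_1 (Ps ! i) =
           (\<Sum>j<length gs. lift_x (A $$ (i, j)) * Var (Y_var j))))
    (invariant_set [generic_comb gs] (ext_map hs F))"

text \<open>A correct implementation of \<open>VectorBasis\<close> is any function returning, for every rational matrix,
  a list of vectors that is a basis of its right kernel.\<close>

definition is_vector_basis :: "(rat mat \<Rightarrow> rat vec list) \<Rightarrow> bool" where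
  "is_vector_basis vb \<longleftrightarrow>
    (\<forall>A. distinct (vb A) \<and> kernel.basis (dim_col A) A (set (vb A)))"

lemma is_vector_basis_exists: "\<exists>vb. is_vector_basis vb"
proof -
  have "\<exists>bs. distinct bs \<and> kernel.basis (dim_col A) A (set bs)" for A :: "rat mat"
  proof -
    have "A \<in> carrier_mat (dim_row A) (dim_col A)" by simp
    from kernel_basis_exists[OF this] show ?thesis
      by (metis finite_distinct_list)
  qed
  then show ?thesis unfolding is_vector_basis_def by metis
qed

text \<open>The coefficient matrix of linear forms in \<open>y\<^sub>0, \<dots>, y\<^sub>m\<^sub>-\<^sub>1\<close>; its right kernel is their common zero
  set.\<close>

definition linear_forms_mat :: "nat \<Rightarrow> (nat, rat) mpoly list \<Rightarrow> rat mat" where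
  "linear_forms_mat m ls =
    mat (length ls) m (\<lambda>(i, j). Poly_Mapping.lookup (ls ! i) (Poly_Mapping.single j 1))"

definition lin_comb :: "('n, rat) mpoly list \<Rightarrow> rat vec \<Rightarrow> ('n, rat) mpoly" where
  "lin_comb gs b = (\<Sum>i<length gs. Const (b $ i) * gs ! i)"

text \<open>In \<open>truncated_ideal\<close>, \<open>pt\<close> is the point \<open>(a, y, 1)\<close> with coordinates in \<open>\<rat>[y]\<close>, and \<open>form i\<close> is
  \<open>g(F\<^sub>m\<^sup>i(a, y, 1))\<close>.\<close>

definition truncated_ideal ::
    "(rat mat \<Rightarrow> rat vec list) \<Rightarrow> ('n \<Rightarrow> rat) \<Rightarrow> ('n, rat) mpoly list \<Rightarrow> ('n, rat) mpoly list \<Rightarrow>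
     ('n \<Rightarrow> ('n, rat) mpoly) \<Rightarrow> ('n, rat) mpoly list option" where
  "truncated_ideal vb a gs hs F =
    (let m = length gs;
         g = generic_comb gs;
         Fm = ext_map hs F;
         pt = (\<lambda>v. case v of X_var i \<Rightarrow> Const (a i) | Y_var j \<Rightarrow> Var j | Z_var \<Rightarrow> 1);
         form = (\<lambda>i. subst (((\<lambda>q v. subst q (Fm v)) ^^ i) pt) g);
         B = map (lin_comb gs) (vb (linear_forms_mat m (map form [0..<m + 1])))
     in
       if \<exists>P\<in>set B. check_pi a P hs F = None then None
       else
         let B' = filter (\<lambda>P. check_pi a P hs F = Some False) B in
         if B' = [] then Some B
         else
           (case compute_matrix B' hs F of
              None \<Rightarrow> None
            | Some A \<Rightarrow>
                let C = map (lin_comb B') (vb (map_mat (eval a) A));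
                    B'' = filter (\<lambda>P. P \<notin> set B') B
                in Some (C @ B'')))"

end

theory Submission
  imports Defs
begin

text \<open>A polynomial \<open>q\<close> is an invariant iff \<open>(T ^^ l) q\<close> vanishes at \<open>a\<close> for all \<open>l\<close>, where
  \<open>T q = h * (q \<circ> F)\<close>: the value of \<open>(T ^^ l) q\<close> at \<open>a\<close> is that of \<open>q\<close> at the \<open>l\<close>-th iterate times
  the product of the values of \<open>h\<close> at the earlier ones, which is zero exactly when the loop has stopped
  before. These conditions are linear over \<open>\<rat>\<close> in the coefficients of \<open>q\<close> with respect to \<open>gs\<close>, so
  the complex solutions are spanned by the rational ones. The iterates computed by \<open>invariant_set\<close>
  are \<open>z\<close> times the \<open>(T ^^ l) q\<close>; the computation stops by Hilbert's basis theorem, and when it does,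
  the conditions found so far imply all the others.\<close>

section \<open>Hilbert's basis theorem\<close>

text \<open>Two obstacles shape the development. First, \<open>('n xyz, rat) mpoly\<close> has
  infinitely many variables and is not Noetherian. A given input involves only finitely many of
  them, so the basis theorem is proved for subrings \<open>R\<close> of an ambient ring, built from
  the constants by adjoining one element at a time. Second, the linear forms of step (2) are only
  necessary conditions: no bound on their number in terms of \<open>m\<close> alone certifies
  invariance, since a polynomial may vanish at arbitrarily many initial points of an orbit and not
  at the next one. What certifies invariance is the radical membership on which
  \<open>invariant_set\<close> stops. In \<open>compute_matrix\<close> it is reached with the
  coefficients \<open>y\<close> still indeterminate, so specialising \<open>y\<close> covers all
  coefficient vectors at once.\<close>

definition is_subring :: "'a::comm_ring_1 set \<Rightarrow> bool" where
  "is_subring R \<longleftrightarrow> 1 \<in> R \<and> (\<forall>x\<in>R. \<forall>y\<in>R. x - y \<in> R \<and> x * y \<in> R)"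

lemma is_subringD:
  assumes "is_subring R"
  shows is_subring_0: "0 \<in> R" and is_subring_1: "1 \<in> R"
    and is_subring_diff: "\<And>x y. x \<in> R \<Longrightarrow> y \<in> R \<Longrightarrow> x - y \<in> R"
    and is_subring_add: "\<And>x y. x \<in> R \<Longrightarrow> y \<in> R \<Longrightarrow> x + y \<in> R"
    and is_subring_mult: "\<And>x y. x \<in> R \<Longrightarrow> y \<in> R \<Longrightarrow> x * y \<in> R"
proof -
  show one: "1 \<in> R" and diff: "\<And>x y. x \<in> R \<Longrightarrow> y \<in> R \<Longrightarrow> x - y \<in> R"
    and "\<And>x y. x \<in> R \<Longrightarrow> y \<in> R \<Longrightarrow> x * y \<in> R"
    using assms unfolding is_subring_def by auto
  show zero: "0 \<in> R" using diff[OF one one] by simp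
  show "x + y \<in> R" if "x \<in> R" "y \<in> R" for x y
    using diff[OF that(1) diff[OF zero that(2)]] by simp
qed

lemma is_subring_sum:
  assumes "is_subring R" "\<And>i. i \<in> A \<Longrightarrow> f i \<in> R"
  shows "sum f A \<in> R"
  using assms(2) by (induction A rule: infinite_finite_induct)
    (auto intro: is_subring_0 is_subring_add assms(1))

lemma is_subring_power: "is_subring R \<Longrightarrow> x \<in> R \<Longrightarrow> x ^ n \<in> R"
  by (induction n) (auto intro: is_subring_1 is_subring_mult)

lemma is_subring_prod:
  assumes "is_subring R" "\<And>i. i \<in> A \<Longrightarrow> f i \<in> R"
  shows "prod f A \<in> R"
  using assms(2) by (induction A rule: infinite_finite_induct)
    (auto intro: is_subring_1 is_subring_mult assms(1))

section \<open>Finitely generated ideals of a subring\<close>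

definition seq_span :: "'a::comm_ring_1 set \<Rightarrow> (nat \<Rightarrow> 'a) \<Rightarrow> nat \<Rightarrow> 'a set" where
  "seq_span R f k = {\<Sum>i<k. r i * f i | r. \<forall>i. r i \<in> R}"

lemma seq_spanI: "(\<And>i. r i \<in> R) \<Longrightarrow> x = (\<Sum>i<k. r i * f i) \<Longrightarrow> x \<in> seq_span R f k"
  by (auto simp: seq_span_def)

context
  fixes R :: "'a::comm_ring_1 set"
  assumes R: "is_subring R"
begin

lemma seq_span_0: "0 \<in> seq_span R f k"
  by (rule seq_spanI[of "\<lambda>_. 0"]) (auto intro: is_subring_0 R)

lemma seq_span_diff:
  assumes "x \<in> seq_span R f k" "y \<in> seq_span R f k"
  shows "x - y \<in> seq_span R f k"
proof -
  from assms obtain r s where "x = (\<Sum>i<k. r i * f i)" "y = (\<Sum>i<k. s i * f i)"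
    "\<forall>i. r i \<in> R" "\<forall>i. s i \<in> R" unfolding seq_span_def by blast
  then show ?thesis
    by (intro seq_spanI[of "\<lambda>i. r i - s i"])
      (auto intro: is_subring_diff R simp: sum_subtractf left_diff_distrib)
qed

lemma seq_span_add:
  assumes "x \<in> seq_span R f k" "y \<in> seq_span R f k"
  shows "x + y \<in> seq_span R f k"
  using seq_span_diff[OF assms(1) seq_span_diff[OF seq_span_0 assms(2)]] by simp

lemma seq_span_mult:
  assumes "x \<in> seq_span R f k" "c \<in> R"
  shows "c * x \<in> seq_span R f k"
proof -
  from assms obtain r where "x = (\<Sum>i<k. r i * f i)" "\<forall>i. r i \<in> R"
    unfolding seq_span_def by blast
  then show ?thesis
    by (intro seq_spanI[of "\<lambda>i. c * r i"])
      (auto intro: is_subring_mult R assms simp: sum_distrib_left mult.assoc)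
qed

lemma seq_span_sum:
  assumes "\<And>i. i \<in> A \<Longrightarrow> g i \<in> seq_span R f k"
  shows "sum g A \<in> seq_span R f k"
  using assms by (induction A rule: infinite_finite_induct) (auto intro: seq_span_0 seq_span_add)

lemma seq_span_base:
  assumes "j < k"
  shows "f j \<in> seq_span R f k"
proof (rule seq_spanI[of "\<lambda>i. if i = j then 1 else 0"])
  show "f j = (\<Sum>i<k. (if i = j then 1 else 0) * f i)"
    using assms by (simp add: if_distrib[of "\<lambda>c. c * _"] cong: if_cong)
qed (auto intro: is_subring_0 is_subring_1 R)

lemma seq_span_minimal:
  assumes "\<And>i. i < k \<Longrightarrow> g i \<in> seq_span R f n"
  shows "seq_span R g k \<subseteq> seq_span R f n"
proof
  fix x assume "x \<in> seq_span R g k"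
  then obtain r where "x = (\<Sum>i<k. r i * g i)" "\<forall>i. r i \<in> R" unfolding seq_span_def by blast
  then show "x \<in> seq_span R f n" by (auto intro!: seq_span_sum seq_span_mult assms)
qed

lemma seq_span_mono: "k \<le> n \<Longrightarrow> seq_span R f k \<subseteq> seq_span R f n"
  by (rule seq_span_minimal) (auto intro: seq_span_base)

end

text \<open>The ascending chain condition along a sequence of generators; for a subring
  \<open>R\<close> it is equivalent to finite generation of every ideal. This form is chosen because
  termination of \<open>invariant_set\<close> can use the index \<open>k\<close> directly. The case
  \<open>k = 0\<close> means \<open>f 0 = 0\<close>.\<close>

definition noetherian :: "'a::comm_ring_1 set \<Rightarrow> bool" where
  "noetherian R \<longleftrightarrow> (\<forall>f. (\<forall>i. f i \<in> R) \<longrightarrow> (\<exists>k. f k \<in> seq_span R f k))"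

text \<open>Values at \<open>x\<close> of polynomials over \<open>R\<close> of degree less than
  \<open>n\<close>. As \<open>x\<close> may satisfy relations over \<open>R\<close>, representations
  need not be unique. The union over all \<open>n\<close> is the subring R[x].\<close>

primrec polys_below :: "'a::comm_ring_1 set \<Rightarrow> 'a \<Rightarrow> nat \<Rightarrow> 'a set" where
  "polys_below R x 0 = {0}"
| "polys_below R x (Suc n) = {d + r * x ^ n | d r. d \<in> polys_below R x n \<and> r \<in> R}"

definition adjoin :: "'a::comm_ring_1 set \<Rightarrow> 'a \<Rightarrow> 'a set" where
  "adjoin R x = (\<Union>n. polys_below R x n)"

context
  fixes R :: "'a::comm_ring_1 set" and x :: 'a
  assumes R: "is_subring R"
begin

lemma polys_below_SucI:
  "d \<in> polys_below R x n \<Longrightarrow> r \<in> R \<Longrightarrow> y = d + r * x ^ n \<Longrightarrow> y \<in> polys_below R x (Suc n)"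
  by auto

lemma polys_below_mono: "m \<le> n \<Longrightarrow> polys_below R x m \<subseteq> polys_below R x n"
proof (rule lift_Suc_mono_le[of "polys_below R x"])
  show "polys_below R x n \<subseteq> polys_below R x (Suc n)" for n
    using polys_below_SucI[OF _ is_subring_0[OF R]] by fastforce
qed

lemma polys_below_0: "0 \<in> polys_below R x n"
  using polys_below_mono[of 0 n] by auto

lemma polys_below_diff:
  "p \<in> polys_below R x n \<Longrightarrow> q \<in> polys_below R x n \<Longrightarrow> p - q \<in> polys_below R x n"
proof (induction n arbitrary: p q)
  case (Suc n)
  from Suc.prems obtain d r e s where *: "p = d + r * x ^ n" "q = e + s * x ^ n"
    "d \<in> polys_below R x n" "e \<in> polys_below R x n" "r \<in> R" "s \<in> R" by auto
  have "p - q = (d - e) + (r - s) * x ^ n" by (simp add: * algebra_simps)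
  then show ?case using polys_below_SucI[OF Suc.IH[OF *(3,4)] is_subring_diff[OF R *(5,6)]] by blast
qed auto

lemma polys_below_add:
  assumes "p \<in> polys_below R x n" "q \<in> polys_below R x n"
  shows "p + q \<in> polys_below R x n"
  using polys_below_diff[OF assms(1) polys_below_diff[OF polys_below_0 assms(2)]] by simp

lemma polys_below_sum:
  assumes "\<And>i. i \<in> A \<Longrightarrow> f i \<in> polys_below R x n"
  shows "sum f A \<in> polys_below R x n"
  using assms by (induction A rule: infinite_finite_induct)
    (auto intro: polys_below_0 polys_below_add)

lemma polys_below_mult: "p \<in> polys_below R x n \<Longrightarrow> c \<in> R \<Longrightarrow> c * p \<in> polys_below R x n"
proof (induction n arbitrary: p)
  case (Suc n)
  from Suc.prems obtain d r where *: "p = d + r * x ^ n" "d \<in> polys_below R x n" "r \<in> R" by auto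
  have "c * p = c * d + (c * r) * x ^ n" by (simp add: * algebra_simps)
  then show ?case
    using polys_below_SucI[OF Suc.IH[OF *(2) Suc.prems(2)] is_subring_mult[OF R Suc.prems(2) *(3)]]
    by blast
qed auto

lemma polys_below_shift: "p \<in> polys_below R x n \<Longrightarrow> x ^ k * p \<in> polys_below R x (n + k)"
proof (induction n arbitrary: p)
  case 0
  then show ?case using polys_below_0 by simp
next
  case (Suc n)
  from Suc.prems obtain d r where *: "p = d + r * x ^ n" "d \<in> polys_below R x n" "r \<in> R" by auto
  have "x ^ k * p = x ^ k * d + r * x ^ (n + k)" by (simp add: * algebra_simps power_add)
  then show ?case using polys_below_SucI[OF Suc.IH[OF *(2)] *(3)] by simp
qed

lemma adjoin_base: "r \<in> R \<Longrightarrow> r \<in> adjoin R x"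
  unfolding adjoin_def
  by (intro UN_I[of 1] UNIV_I) (use polys_below_SucI[of 0 0 r r] in simp)

lemma adjoin_var: "x \<in> adjoin R x"
  using polys_below_SucI[OF polys_below_0 is_subring_1[OF R], of _ 1]
  unfolding adjoin_def by fastforce

lemma adjoin_obtain_common:
  assumes "p \<in> adjoin R x" "q \<in> adjoin R x"
  obtains n where "p \<in> polys_below R x n" "q \<in> polys_below R x n"
proof -
  obtain m n where "p \<in> polys_below R x m" "q \<in> polys_below R x n"
    using assms unfolding adjoin_def by blast
  then show ?thesis using that[of "max m n"] polys_below_mono[of m "max m n"]
      polys_below_mono[of n "max m n"] by auto
qed

lemma adjoin_is_subring: "is_subring (adjoin R x)"
  unfolding is_subring_def
proof (intro conjI ballI)
  show "1 \<in> adjoin R x" by (intro adjoin_base is_subring_1 R)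
  fix p q assume p: "p \<in> adjoin R x" and q: "q \<in> adjoin R x"
  have diff: "p - q \<in> adjoin R x" if pq: "p \<in> adjoin R x" "q \<in> adjoin R x" for p q
  proof -
    obtain n where "p \<in> polys_below R x n" "q \<in> polys_below R x n"
      using adjoin_obtain_common[OF pq] by blast
    then show ?thesis using polys_below_diff unfolding adjoin_def by blast
  qed
  then show "p - q \<in> adjoin R x" using p q .
  have zero: "0 \<in> adjoin R x" using polys_below_0 unfolding adjoin_def by blast
  have add: "p + q \<in> adjoin R x" if "p \<in> adjoin R x" "q \<in> adjoin R x" for p q
    using diff[OF that(1) diff[OF zero that(2)]] by simp
  obtain m where q: "q \<in> polys_below R x m" using q unfolding adjoin_def by blast
  have "p * q \<in> adjoin R x" if "p \<in> polys_below R x n" for n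
    using that
  proof (induction n arbitrary: p)
    case (Suc n)
    from Suc.prems obtain d r where *: "p = d + r * x ^ n" "d \<in> polys_below R x n" "r \<in> R" by auto
    have "r * (x ^ n * q) \<in> adjoin R x"
      using polys_below_mult[OF polys_below_shift[OF q] *(3)] unfolding adjoin_def by blast
    from add[OF Suc.IH[OF *(2)] this] show ?case by (simp add: *(1) algebra_simps)
  qed (simp add: zero)
  then show "p * q \<in> adjoin R x" using p unfolding adjoin_def by blast
qed

text \<open>Sarges' argument: among the elements of a non-finitely generated
  ideal not yet generated, always pick one of least degree; the leading coefficients then violate
  the assumption on \<open>R\<close>. The element \<open>x\<close> may be algebraic over \<open>R\<close>: only the least degree of a
  representation is used.\<close>

theorem noetherian_adjoin:
  assumes "noetherian R"
  shows "noetherian (adjoin R x)"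
  unfolding noetherian_def
proof (intro allI impI, rule ccontr)
  let ?S = "adjoin R x"
  fix f assume f: "\<forall>i. f i \<in> ?S" and "\<nexists>k. f k \<in> seq_span ?S f k"
  then have no: "f k \<notin> seq_span ?S f k" for k by blast
  note S = adjoin_is_subring
  \<comment> \<open>One more than the least degree of a representation, so that 0 is the only
    element of \<open>?S\<close> with \<open>deg\<close> 0.\<close>
  define deg where "deg p = (LEAST n. p \<in> polys_below R x n)" for p
  have deg: "p \<in> polys_below R x (deg p)" if "p \<in> ?S" for p
    using that unfolding deg_def adjoin_def by (auto intro: LeastI)
  have deg_le: "deg p \<le> n" if "p \<in> polys_below R x n" for p n
    using that unfolding deg_def by (rule Least_le)
  define I where "I = (\<Union>k. seq_span ?S f k)"
  have IS: "I \<subseteq> ?S"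
  proof
    fix p assume "p \<in> I"
    then obtain k r where "p = (\<Sum>i<k. r i * f i)" "\<forall>i. r i \<in> ?S"
      unfolding I_def seq_span_def by blast
    then show "p \<in> ?S" using f by (auto intro!: is_subring_sum[OF S] is_subring_mult[OF S])
  qed
  have I_common: "\<exists>n. \<forall>i<k. g i \<in> seq_span ?S f n" if "\<forall>i<k. g i \<in> I" for g :: "nat \<Rightarrow> 'a" and k
  proof -
    from that have "\<forall>i. \<exists>n. i < k \<longrightarrow> g i \<in> seq_span ?S f n" unfolding I_def by blast
    then obtain n where n: "\<forall>i<k. g i \<in> seq_span ?S f (n i)" by metis
    have "n i \<le> Max (n ` {..<k})" if "i < k" for i using that by simp
    then show ?thesis using n seq_span_mono[OF S] by blast
  qed
  \<comment> \<open>The admissible choices for the \<open>k\<close>-th element depend on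
    \<open>g\<close> only below \<open>k\<close>, so that \<open>g\<close> can be chosen by
    well-founded recursion.\<close>
  define P where "P g k r \<longleftrightarrow> r \<in> I \<and> r \<notin> seq_span ?S g k \<and>
      (\<forall>r'\<in>I. r' \<notin> seq_span ?S g k \<longrightarrow> deg r \<le> deg r')" for g k r
  have "\<exists>g. \<forall>k. P g k (g k)"
  proof (rule dependent_wellorder_choice)
    fix r :: 'a and g g' :: "nat \<Rightarrow> 'a" and k
    assume "\<And>y. y < k \<Longrightarrow> g y = g' y"
    then have "seq_span ?S g k = seq_span ?S g' k" by (simp add: seq_span_def)
    then show "P g k r = P g' k r" by (simp add: P_def)
  next
    fix k and g :: "nat \<Rightarrow> 'a"
    assume "\<And>y. y < k \<Longrightarrow> P g y (g y)"
    then have "\<forall>i<k. g i \<in> I" by (simp add: P_def)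
    then obtain n where n: "\<forall>i<k. g i \<in> seq_span ?S f n" using I_common by blast
    then have "f n \<notin> seq_span ?S g k" using no seq_span_minimal[OF S, of k g f n] by blast
    moreover have "f n \<in> I" unfolding I_def using seq_span_base[OF S, of n "Suc n" f] by blast
    ultimately show "\<exists>r. P g k r"
      using ex_has_least_nat[of "\<lambda>r. r \<in> I \<and> r \<notin> seq_span ?S g k" "f n" deg] unfolding P_def by blast
  qed
  then obtain g where g: "\<And>k. g k \<in> I" "\<And>k. g k \<notin> seq_span ?S g k"
    and least: "\<And>k r. r \<in> I \<Longrightarrow> r \<notin> seq_span ?S g k \<Longrightarrow> deg (g k) \<le> deg r"
    unfolding P_def by blast
  \<comment> \<open>\<open>deg (g k)\<close> is positive because 0 lies in every span;
    \<open>a\<close> is then the leading coefficient of a representation of least degree.\<close>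
  have "\<exists>n d a. deg (g k) = Suc n \<and> d \<in> polys_below R x n \<and> a \<in> R \<and> g k = d + a * x ^ n" for k
  proof (cases "deg (g k)")
    case 0
    then have "g k = 0" using deg[of "g k"] g(1) IS by auto
    then show ?thesis using g(2) seq_span_0[OF S] by metis
  next
    case (Suc n)
    then show ?thesis using deg[of "g k"] g(1) IS by auto
  qed
  then obtain n d a where n: "\<And>k. deg (g k) = Suc (n k)" and d: "\<And>k. d k \<in> polys_below R x (n k)"
    and a: "\<And>k. a k \<in> R" and gk: "\<And>k. g k = d k + a k * x ^ n k" by metis
  obtain k r where r: "\<And>i. r i \<in> R" and ak: "a k = (\<Sum>i<k. r i * a i)"
    using assms a unfolding noetherian_def seq_span_def by blast
  \<comment> \<open>\<open>g k\<close> was already a candidate when \<open>g i\<close> was picked,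
    because the spans grow with the index.\<close>
  have n_mono: "n i \<le> n k" if "i < k" for i
    using least[OF g(1), of k i] g(2)[of k] seq_span_mono[OF S, of i k g] that n by auto
  \<comment> \<open>The earlier elements, shifted to the top degree of \<open>g k\<close> and
    combined with the \<open>r i\<close>, have leading term \<open>a k * x ^ n k\<close>. As
    \<open>q\<close> is already generated, \<open>g k - q\<close> is still a candidate at stage
    \<open>k\<close>, but with the leading term cancelled.\<close>
  define q where "q = (\<Sum>i<k. (r i * x ^ (n k - n i)) * g i)"
  have "r i * x ^ (n k - n i) \<in> ?S" for i
    by (intro is_subring_mult[OF S] is_subring_power[OF S] adjoin_base adjoin_var r)
  then have q: "q \<in> seq_span ?S g k" unfolding q_def by (rule seq_spanI[OF _ refl])
  have "g k - q \<notin> seq_span ?S g k"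
    using g(2)[of k] seq_span_add[OF S, of "g k - q" g k q] q by auto
  moreover have "g k - q \<in> I"
  proof -
    obtain N where N: "\<forall>i<Suc k. g i \<in> seq_span ?S f N" using I_common[of "Suc k" g] g(1) by blast
    then have "q \<in> seq_span ?S f N" using seq_span_minimal[OF S, of k g f N] q by auto
    with N have "g k - q \<in> seq_span ?S f N" by (intro seq_span_diff[OF S]) auto
    then show ?thesis unfolding I_def by blast
  qed
  ultimately have "deg (g k) \<le> deg (g k - q)" by (rule least[rotated])
  moreover have "g k - q \<in> polys_below R x (n k)"
  proof -
    have "r i * x ^ (n k - n i) * g i = r i * (x ^ (n k - n i) * d i) + (r i * a i) * x ^ n k"
      if "i < k" for i
    proof -
      have "x ^ n k = x ^ (n k - n i) * x ^ n i" using n_mono[OF that] by (simp flip: power_add)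
      then show ?thesis by (simp add: gk algebra_simps)
    qed
    then have "q = (\<Sum>i<k. r i * (x ^ (n k - n i) * d i)) + a k * x ^ n k"
      unfolding q_def ak by (simp add: sum.distrib sum_distrib_right)
    then have "g k - q = d k - (\<Sum>i<k. r i * (x ^ (n k - n i) * d i))" by (simp add: gk)
    moreover have "r i * (x ^ (n k - n i) * d i) \<in> polys_below R x (n k)" if "i < k" for i
      using polys_below_mult[OF polys_below_shift[OF d[of i], of "n k - n i"] r] n_mono[OF that]
      by simp
    ultimately show ?thesis by (auto intro!: polys_below_diff d polys_below_sum)
  qed
  ultimately show False using deg_le[of "g k - q" "n k"] n[of k] by linarith
qed

end

text \<open>A nonzero element of the image is a unit there, so the first term of a sequence is
  either zero (\<open>k = 0\<close>) or divides the second (\<open>k = 1\<close>).\<close>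

lemma noetherian_field_image:
  assumes "\<And>c. c \<noteq> 0 \<Longrightarrow> h (inverse (c::'k::field)) * h c = (1::'a::comm_ring_1)" and "h 0 = 0"
    and "is_subring (range h)"
  shows "noetherian (range h)"
  unfolding noetherian_def
proof (intro allI impI)
  fix f assume f: "\<forall>i::nat. f i \<in> range h"
  show "\<exists>k. f k \<in> seq_span (range h) f k"
  proof (cases "f 0 = 0")
    case True
    then show ?thesis by (intro exI[of _ 0]) (simp add: seq_span_0 assms(3))
  next
    case False
    from f obtain c where c: "f 0 = h c" by auto
    have "f 1 = (f 1 * h (inverse c)) * f 0"
      using False assms(1)[of c] c assms(2) by (metis mult.assoc mult.right_neutral)
    then show ?thesis using f c
      by (intro exI[of _ 1] seq_spanI[of "\<lambda>_. f 1 * h (inverse c)"] is_subring_mult[OF assms(3)]) auto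
  qed
qed

section \<open>Evaluation and substitution\<close>

lemma poly_mapping_sum_single:
  fixes p :: "'k \<Rightarrow>\<^sub>0 'b::comm_monoid_add"
  shows "p = (\<Sum>m\<in>Poly_Mapping.keys p. Poly_Mapping.single m (Poly_Mapping.lookup p m))"
  by (rule poly_mapping_eqI) (auto simp: lookup_sum lookup_single when_def in_keys_iff)

definition monomial_value :: "('v \<Rightarrow> 'b::comm_ring_1) \<Rightarrow> ('v \<Rightarrow>\<^sub>0 nat) \<Rightarrow> 'b" where
  "monomial_value x m = (\<Prod>v\<in>Poly_Mapping.keys m. x v ^ Poly_Mapping.lookup m v)"

context
  fixes \<phi> :: "'a::comm_ring_1 \<Rightarrow> 'b::comm_ring_1" and x :: "'v \<Rightarrow> 'b"
  assumes hom: "comm_ring_hom \<phi>"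
begin

interpretation \<phi>: comm_ring_hom \<phi> by (rule hom)

lemma monomial_value_superset:
  assumes "finite A" "Poly_Mapping.keys m \<subseteq> A"
  shows "monomial_value x m = (\<Prod>v\<in>A. x v ^ Poly_Mapping.lookup m v)"
  unfolding monomial_value_def using assms
  by (intro prod.mono_neutral_left) (auto simp: in_keys_iff)

lemma monomial_value_add: "monomial_value x (m + n) = monomial_value x m * monomial_value x n"
proof -
  let ?A = "Poly_Mapping.keys m \<union> Poly_Mapping.keys n"
  have "monomial_value x k = (\<Prod>v\<in>?A. x v ^ Poly_Mapping.lookup k v)" if "k \<in> {m, n, m + n}" for k
    using that Poly_Mapping.keys_add[of m n] by (intro monomial_value_superset) auto
  then show ?thesis by (simp add: lookup_add power_add prod.distrib)
qed

lemma eval_via_superset: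
  assumes "finite A" "Poly_Mapping.keys p \<subseteq> A"
  shows "eval_via \<phi> x p = (\<Sum>m\<in>A. \<phi> (Poly_Mapping.lookup p m) * monomial_value x m)"
  unfolding eval_via_def monomial_value_def[symmetric] using assms
  by (intro sum.mono_neutral_left) (auto simp: in_keys_iff)

lemma eval_via_add: "eval_via \<phi> x (p + q) = eval_via \<phi> x p + eval_via \<phi> x q"
proof -
  let ?A = "Poly_Mapping.keys p \<union> Poly_Mapping.keys q"
  have "eval_via \<phi> x r = (\<Sum>m\<in>?A. \<phi> (Poly_Mapping.lookup r m) * monomial_value x m)"
    if "r \<in> {p, q, p + q}" for r
    using that Poly_Mapping.keys_add[of p q] by (intro eval_via_superset) auto
  then show ?thesis by (simp add: lookup_add \<phi>.hom_add distrib_right sum.distrib)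
qed

lemma eval_via_sum: "eval_via \<phi> x (sum f A) = (\<Sum>i\<in>A. eval_via \<phi> x (f i))"
  by (induction A rule: infinite_finite_induct) (auto simp: eval_via_add, auto simp: eval_via_def)

lemma eval_via_single: "eval_via \<phi> x (Poly_Mapping.single m c) = \<phi> c * monomial_value x m"
  by (subst eval_via_superset[of "{m}"]) auto

lemma eval_via_comm_ring_hom: "comm_ring_hom (eval_via \<phi> x)"
proof unfold_locales
  fix p q :: "('v, 'a) mpoly"
  \<comment> \<open>With both factors written as sums of single monomials, additivity and the values
    at monomials suffice, and the convolution product need not be unfolded.\<close>
  have pq: "p * q =
    (\<Sum>m\<in>Poly_Mapping.keys p. \<Sum>n\<in>Poly_Mapping.keys q.
       Poly_Mapping.single (m + n) (Poly_Mapping.lookup p m * Poly_Mapping.lookup q n))"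
    unfolding mult_single[symmetric] sum_product[symmetric] poly_mapping_sum_single[symmetric] ..
  have "eval_via \<phi> x (p * q) =
    (\<Sum>m\<in>Poly_Mapping.keys p. \<Sum>n\<in>Poly_Mapping.keys q.
       \<phi> (Poly_Mapping.lookup p m * Poly_Mapping.lookup q n) * monomial_value x (m + n))"
    by (simp only: pq eval_via_sum eval_via_single)
  also have "\<dots> = eval_via \<phi> x p * eval_via \<phi> x q"
    by (simp add: eval_via_superset[OF finite_keys order_refl] sum_product monomial_value_add
        \<phi>.hom_mult mult_ac)
  finally show "eval_via \<phi> x (p * q) = eval_via \<phi> x p * eval_via \<phi> x q" .
  show "eval_via \<phi> x 1 = 1" by (simp add: eval_via_def)
qed (auto simp: eval_via_add, auto simp: eval_via_def)

lemma eval_via_Const: "eval_via \<phi> x (Const c) = \<phi> c"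
  by (simp add: Const_def eval_via_single monomial_value_def)

lemma eval_via_Var: "eval_via \<phi> x (Var v) = x v"
  by (simp add: Var_def eval_via_single monomial_value_def)

end

text \<open>The common source of the composition laws below: \<open>h\<close> is taken to be an
  evaluation, a substitution or \<open>Const\<close>.\<close>

lemma comm_ring_hom_eval_via:
  assumes "comm_ring_hom h"
  shows "h (eval_via \<phi> x p) = eval_via (\<lambda>c. h (\<phi> c)) (\<lambda>v. h (x v)) p"
proof -
  interpret comm_ring_hom h by fact
  show ?thesis by (simp add: eval_via_def hom_sum hom_mult hom_prod hom_power)
qed

section \<open>Constants, variables and composition of substitutions\<close>

lemma Const_comm_ring_hom: "comm_ring_hom (Const :: 'a::comm_ring_1 \<Rightarrow> ('v, 'a) mpoly)"
  by unfold_locales (auto simp: Const_def single_add mult_single)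

interpretation Const: comm_ring_hom "Const :: 'a::comm_ring_1 \<Rightarrow> ('v, 'a) mpoly"
  by (rule Const_comm_ring_hom)

lemma id_comm_ring_hom: "comm_ring_hom (\<lambda>c. c :: 'a::comm_ring_1)"
  by unfold_locales auto

interpretation eval: comm_ring_hom "eval x" for x :: "'v \<Rightarrow> 'a::comm_ring_1"
  unfolding eval_def by (rule eval_via_comm_ring_hom[OF id_comm_ring_hom])

interpretation subst: comm_ring_hom "subst f" for f :: "'v \<Rightarrow> ('w, 'a::comm_ring_1) mpoly"
  unfolding subst_def by (rule eval_via_comm_ring_hom[OF Const_comm_ring_hom])

lemma eval_Const [simp]: "eval x (Const c) = c"
  and eval_Var [simp]: "eval x (Var v) = x v"
  unfolding eval_def
  by (rule eval_via_Const[OF id_comm_ring_hom] eval_via_Var[OF id_comm_ring_hom])+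

lemma subst_Const [simp]: "subst f (Const c) = Const c"
  and subst_Var [simp]: "subst f (Var v) = f v"
  unfolding subst_def
  by (rule eval_via_Const[OF Const_comm_ring_hom] eval_via_Var[OF Const_comm_ring_hom])+

lemma eval_subst: "eval x (subst f p) = eval (\<lambda>v. eval x (f v)) p"
proof -
  have "eval x (subst f p) = eval_via (\<lambda>c. eval x (Const c)) (\<lambda>v. eval x (f v)) p"
    unfolding subst_def by (rule comm_ring_hom_eval_via[OF eval.comm_ring_hom_axioms])
  then show ?thesis by (simp flip: eval_def)
qed

lemma subst_subst: "subst f (subst g p) = subst (\<lambda>v. subst f (g v)) p"
proof -
  have "subst f (subst g p) = eval_via (\<lambda>c. subst f (Const c)) (\<lambda>v. subst f (g v)) p"
    by (subst (2) subst_def) (rule comm_ring_hom_eval_via[OF subst.comm_ring_hom_axioms])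
  then show ?thesis by (simp flip: subst_def)
qed

lemma subst_Const_point: "subst (\<lambda>v. Const (x v)) p = Const (eval x p)"
  unfolding eval_def comm_ring_hom_eval_via[OF Const_comm_ring_hom] subst_def ..

lemma monomial_value_Var:
  "monomial_value Var m = (Poly_Mapping.single m 1 :: ('v, 'a::comm_ring_1) mpoly)"
proof -
  have pow: "Var v ^ n = (Poly_Mapping.single (Poly_Mapping.single v n) 1 :: ('v, 'a) mpoly)" for v n
    by (induction n) (auto simp: Var_def mult_single simp flip: single_add)
  have "(\<Prod>v\<in>A. Var v ^ Poly_Mapping.lookup m v :: ('v, 'a) mpoly) =
      Poly_Mapping.single (\<Sum>v\<in>A. Poly_Mapping.single v (Poly_Mapping.lookup m v)) 1" for A
    by (induction A rule: infinite_finite_induct) (auto simp: pow mult_single)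
  then show ?thesis by (simp add: monomial_value_def flip: poly_mapping_sum_single)
qed

lemma subst_Var_id: "subst Var p = p"
  unfolding subst_def eval_via_def monomial_value_def[symmetric]
  by (simp add: monomial_value_Var Const_def mult_single flip: poly_mapping_sum_single)

section \<open>Linear combinations and kernels\<close>

lemma lookup_Const_mult:
  fixes p :: "('v, 'a::comm_ring_1) mpoly"
  shows "Poly_Mapping.lookup (Const c * p) m = c * Poly_Mapping.lookup p m"
proof -
  have "Const c * p = (\<Sum>m\<in>Poly_Mapping.keys p. Const c * Poly_Mapping.single m (Poly_Mapping.lookup p m))"
    unfolding sum_distrib_left[symmetric] poly_mapping_sum_single[symmetric] ..
  then show ?thesis
    by (simp add: Const_def mult_single lookup_sum lookup_single when_def in_keys_iff)
qed

text \<open>Coefficients are attached to positions, so repeated entries count separately, as they do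
  for the coefficient vectors of the algorithm. The coefficient ring is left open because both
  \<rat> and \<complex> occur.\<close>

definition list_comb :: "('v, 'a::comm_ring_1) mpoly list \<Rightarrow> (nat \<Rightarrow> 'a) \<Rightarrow> ('v, 'a) mpoly" where
  "list_comb ps c = (\<Sum>i<length ps. Const (c i) * ps ! i)"

definition list_span :: "('v, 'a::comm_ring_1) mpoly list \<Rightarrow> ('v, 'a) mpoly set" where
  "list_span ps = range (list_comb ps)"

definition list_independent :: "('v, 'a::comm_ring_1) mpoly list \<Rightarrow> bool" where
  "list_independent ps \<longleftrightarrow> (\<forall>c. list_comb ps c = 0 \<longrightarrow> (\<forall>i<length ps. c i = 0))"

lemma lin_comb_eq_list_comb: "lin_comb gs b = list_comb gs (($) b)"
  by (simp add: lin_comb_def list_comb_def)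

lemma lookup_list_comb:
  "Poly_Mapping.lookup (list_comb ps c) m = (\<Sum>i<length ps. c i * Poly_Mapping.lookup (ps ! i) m)"
  by (simp add: list_comb_def lookup_sum lookup_Const_mult)

lemma list_comb_cong: "(\<And>i. i < length ps \<Longrightarrow> c i = d i) \<Longrightarrow> list_comb ps c = list_comb ps d"
  by (simp add: list_comb_def)

lemma list_comb_add: "list_comb ps c + list_comb ps d = list_comb ps (\<lambda>i. c i + d i)"
  by (simp add: list_comb_def Const.hom_add distrib_right sum.distrib)

lemma list_comb_Const_mult: "Const a * list_comb ps c = list_comb ps (\<lambda>i. a * c i)"
  by (simp add: list_comb_def Const.hom_mult sum_distrib_left mult.assoc)

lemma list_comb_0: "list_comb ps (\<lambda>i. 0) = 0"
  by (simp add: list_comb_def)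

lemma list_comb_unit:
  assumes "i < length ps"
  shows "list_comb ps (\<lambda>j. if j = i then 1 else 0) = ps ! i"
proof -
  have "list_comb ps (\<lambda>j. if j = i then 1 else 0) = (\<Sum>j<length ps. if j = i then ps ! j else 0)"
    unfolding list_comb_def by (intro sum.cong) auto
  then show ?thesis using assms by simp
qed

lemma list_span_0: "0 \<in> list_span ps"
  unfolding list_span_def by (metis list_comb_0 rangeI)

lemma list_span_add: "x \<in> list_span ps \<Longrightarrow> y \<in> list_span ps \<Longrightarrow> x + y \<in> list_span ps"
  unfolding list_span_def by (auto simp: list_comb_add)

lemma list_span_Const_mult: "x \<in> list_span ps \<Longrightarrow> Const a * x \<in> list_span ps"
  unfolding list_span_def by (auto simp: list_comb_Const_mult)

lemma list_span_sum: "(\<And>i. i \<in> A \<Longrightarrow> f i \<in> list_span ps) \<Longrightarrow> sum f A \<in> list_span ps"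
  by (induction A rule: infinite_finite_induct) (auto intro: list_span_0 list_span_add)

lemma list_span_base: "set ps \<subseteq> list_span ps"
proof
  fix p assume "p \<in> set ps"
  then obtain i where "i < length ps" "p = ps ! i" by (metis in_set_conv_nth)
  then have "p = list_comb ps (\<lambda>j. if j = i then 1 else 0)" by (simp add: list_comb_unit)
  then show "p \<in> list_span ps" unfolding list_span_def by blast
qed

lemma list_span_minimal:
  assumes "set ps \<subseteq> list_span qs"
  shows "list_span ps \<subseteq> list_span qs"
proof
  fix x assume "x \<in> list_span ps"
  then obtain c where "x = (\<Sum>i<length ps. Const (c i) * ps ! i)"
    unfolding list_span_def list_comb_def by auto
  then show "x \<in> list_span qs" using assms
    by (auto intro!: list_span_sum list_span_Const_mult)
qed

lemma list_span_mono: "set ps \<subseteq> set qs \<Longrightarrow> list_span ps \<subseteq> list_span qs"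
  using list_span_base list_span_minimal by blast

lemma list_comb_append:
  fixes ps qs :: "('v, 'a::comm_ring_1) mpoly list"
  shows "list_comb (ps @ qs) c = list_comb ps c + list_comb qs (\<lambda>i. c (length ps + i))"
proof -
  have "(\<Sum>i<m + n. f i) = (\<Sum>i<m. f i) + (\<Sum>i<n. f (m + i))"
    for m n and f :: "nat \<Rightarrow> ('v, 'a) mpoly"
    by (induction n) (simp_all add: add.assoc)
  then show ?thesis unfolding list_comb_def by (simp add: nth_append)
qed

lemma list_independentD: "list_independent ps \<Longrightarrow> list_comb ps c = 0 \<Longrightarrow> i < length ps \<Longrightarrow> c i = 0"
  by (simp add: list_independent_def)

lemma list_independent_appendD:
  assumes "list_independent (ps @ qs)"
  shows "list_independent ps"
  unfolding list_independent_def
proof (intro allI impI)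
  fix c i assume c: "list_comb ps c = 0" and i: "i < length ps"
  let ?c = "\<lambda>i. if i < length ps then c i else 0"
  have "list_comb ps ?c = list_comb ps c" by (rule list_comb_cong) simp
  then have "list_comb (ps @ qs) ?c = 0" by (simp add: list_comb_append c list_comb_0)
  from list_independentD[OF assms this, of i] i show "c i = 0" by simp
qed

text \<open>A combination of \<open>rs\<close> can be rewritten over \<open>ps\<close>; independence
  of \<open>ps @ qs\<close> then makes the \<open>ps\<close> part and the \<open>qs\<close> part
  vanish separately. Later \<open>B'\<close> is replaced by \<open>C\<close> in this way.\<close>

lemma list_independent_append_replace:
  assumes "list_independent (ps @ qs)" "set rs \<subseteq> list_span ps" "list_independent rs"
  shows "list_independent (rs @ qs)"
  unfolding list_independent_def list_comb_append
proof (intro allI impI)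
  fix c i assume 0: "list_comb rs c + list_comb qs (\<lambda>i. c (length rs + i)) = 0"
    and i: "i < length (rs @ qs)"
  obtain d where d: "list_comb rs c = list_comb ps d"
    using list_span_minimal[OF assms(2)] unfolding list_span_def by blast
  let ?e = "\<lambda>i. if i < length ps then d i else c (length rs + (i - length ps))"
  have "list_comb ps ?e = list_comb ps d" by (rule list_comb_cong) simp
  then have "list_comb (ps @ qs) ?e = 0" using 0 d by (simp add: list_comb_append)
  note e = list_independentD[OF assms(1) this]
  have "d i = 0" if "i < length ps" for i using e[of i] that by simp
  then have "list_comb ps d = list_comb ps (\<lambda>i. 0)" by (rule list_comb_cong)
  then have rs: "c i = 0" if "i < length rs" for i
    using list_independentD[OF assms(3), of c] that d by (simp add: list_comb_0)
  have qs: "c (length rs + j) = 0" if "j < length qs" for j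
    using e[of "length ps + j"] that by simp
  show "c i = 0" using rs[of i] qs[of "i - length rs"] i by (cases "i < length rs") auto
qed

section \<open>Complex polynomials as a vector space\<close>

interpretation mpoly: vector_space "mpoly_scale :: complex \<Rightarrow> ('v, complex) mpoly \<Rightarrow> _"
  by unfold_locales (auto simp: mpoly_scale_def algebra_simps Const.hom_add Const.hom_mult)

lemma mpoly_span_set: "mpoly_span (set ps) = list_span ps"
proof
  show "mpoly_span (set ps) \<subseteq> list_span ps"
    unfolding mpoly_span_def
    by (rule mpoly.span_minimal[OF list_span_base])
      (auto intro!: mpoly.subspaceI list_span_0 list_span_add list_span_Const_mult simp: mpoly_scale_def)
  show "list_span ps \<subseteq> mpoly_span (set ps)"
    unfolding list_span_def list_comb_def mpoly_span_def mpoly_scale_def[symmetric]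
    by (auto intro!: mpoly.span_sum mpoly.span_scale intro: mpoly.span_base)
qed

text \<open>Turns coefficients attached to positions into coefficients attached to values, as the
  set-based notions of linear dependence require.\<close>

lemma distinct_nth_factor:
  assumes "distinct xs"
  shows "\<exists>u. \<forall>i<length xs. u (xs ! i) = c i"
proof -
  have "(THE i'. i' < length xs \<and> xs ! i' = xs ! i) = i" if "i < length xs" for i
    using that assms by (intro the_equality) (auto simp: nth_eq_iff_index_eq)
  then show ?thesis
    by (intro exI[of _ "\<lambda>v. c (THE i. i < length xs \<and> xs ! i = v)"]) simp
qed

lemma mpoly_independent_iff: "mpoly_independent ps \<longleftrightarrow> list_independent ps"
proof -
  have sum_set: "(\<Sum>v\<in>set ps. mpoly_scale (u v) v) = list_comb ps (\<lambda>i. u (ps ! i))"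
    if "distinct ps" for u
    unfolding list_comb_def mpoly_scale_def[symmetric]
    by (rule sum.reindex_bij_betw[OF bij_betw_nth[OF that refl refl], symmetric])
  have "distinct ps" if "list_independent ps"
    unfolding distinct_conv_nth
  proof (intro allI impI notI)
    fix i j assume ij: "i < length ps" "j < length ps" "i \<noteq> j" "ps ! i = ps ! j"
    \<comment> \<open>Two equal entries at different positions give a nontrivial relation, the
      difference of two unit vectors.\<close>
    let ?e = "\<lambda>i j. if j = i then 1 else (0::complex)"
    have "list_comb ps (?e i) + Const (-1) * list_comb ps (?e j) = 0"
      using ij by (simp add: list_comb_unit Const.hom_uminus)
    then have "list_comb ps (\<lambda>k. ?e i k + (-1) * ?e j k) = 0"
      unfolding list_comb_Const_mult list_comb_add .
    from list_independentD[OF that this ij(1)] ij(3) show False by simp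
  qed
  moreover have "\<not> mpoly.dependent (set ps) \<longleftrightarrow> list_independent ps" if dist: "distinct ps"
  proof -
    have dep: "mpoly.dependent (set ps) \<longleftrightarrow>
        (\<exists>u. (\<exists>i<length ps. u (ps ! i) \<noteq> 0) \<and> list_comb ps (\<lambda>i. u (ps ! i)) = 0)"
      unfolding mpoly.dependent_finite[OF finite_set] sum_set[OF dist] by (simp add: set_conv_nth Bex_def) blast
    show ?thesis
    proof
      assume *: "\<not> mpoly.dependent (set ps)"
      show "list_independent ps"
        unfolding list_independent_def
      proof (intro allI impI)
        fix c i assume c: "list_comb ps c = 0" and i: "i < length ps"
        obtain u where u: "\<forall>i<length ps. u (ps ! i) = c i" using distinct_nth_factor[OF dist] by blast
        then have "list_comb ps (\<lambda>i. u (ps ! i)) = 0" using c list_comb_cong[of ps _ c] by metis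
        then show "c i = 0" using * i u unfolding dep by metis
      qed
    qed (auto simp: dep list_independent_def)
  qed
  ultimately show ?thesis unfolding mpoly_independent_def by blast
qed

text \<open>Writing the coordinates of a complex solution in terms of a \<open>\<rat>\<close>-basis of their \<open>\<rat>\<close>-span
  splits it into rational solutions.\<close>

lemma complex_solution_decomposition:
  fixes c :: "nat \<Rightarrow> complex" and u :: "'l \<Rightarrow> nat \<Rightarrow> rat"
  assumes "\<And>l. (\<Sum>j<m. c j * of_rat (u l j)) = 0"
  obtains B :: "complex set" and q :: "complex \<Rightarrow> nat \<Rightarrow> rat"
  where "\<forall>j<m. c j = (\<Sum>b\<in>B. of_rat (q b j) * b)"
    and "\<forall>b\<in>B. \<forall>l. (\<Sum>j<m. q b j * u l j) = 0"
proof -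
  interpret Q: vector_space "\<lambda>(r::rat) (z::complex). of_rat r * z"
    by unfold_locales (auto simp: algebra_simps of_rat_add of_rat_mult)
  obtain B where B: "B \<subseteq> c ` {..<m}" "Q.independent B" "c ` {..<m} \<subseteq> Q.span B"
    using Q.maximal_independent_subset .
  have fin: "finite B" using B(1) finite_surj by blast
  have "\<exists>r. c j = (\<Sum>b\<in>B. of_rat (r b) * b)" if "j < m" for j
    using B(3) that unfolding Q.span_finite[OF fin] by blast
  then obtain q' where q': "\<And>j. j < m \<Longrightarrow> c j = (\<Sum>b\<in>B. of_rat (q' j b) * b)" by metis
  have "(\<Sum>j<m. q' j b * u l j) = 0" if "b \<in> B" for b l
  proof -
    \<comment> \<open>Expanding the solution in \<open>B\<close> and collecting the coefficient of
      each \<open>b\<close> gives a rational relation on the independent set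
      \<open>B\<close>.\<close>
    have "0 = (\<Sum>j<m. \<Sum>b\<in>B. of_rat (q' j b * u l j) * b)"
      unfolding assms[of l, symmetric]
      by (intro sum.cong) (simp_all add: q' of_rat_mult sum_distrib_left mult_ac)
    also have "\<dots> = (\<Sum>b\<in>B. of_rat (\<Sum>j<m. q' j b * u l j) * b)"
      by (subst sum.swap) (simp add: of_rat_sum sum_distrib_right)
    finally show ?thesis using B(2) that unfolding Q.dependent_finite[OF fin] by force
  qed
  then show ?thesis using that[of "\<lambda>b j. q' j b" B] q' by blast
qed

section \<open>Rational polynomials inside the complex ones\<close>

lemma lookup_to_complex: "Poly_Mapping.lookup (to_complex p) m = of_rat (Poly_Mapping.lookup p m)"
  unfolding to_complex_def by (simp add: map.rep_eq when_def)

lemma keys_to_complex: "Poly_Mapping.keys (to_complex p) = Poly_Mapping.keys p"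
  by (auto simp: in_keys_iff lookup_to_complex)

lemma eval_to_complex: "eval (\<lambda>v. of_rat (x v)) (to_complex p) = of_rat (eval x p)"
  by (simp add: eval_def eval_via_def keys_to_complex lookup_to_complex of_rat_sum of_rat_mult
      of_rat_prod of_rat_power)

lemma to_complex_list_comb:
  "to_complex (list_comb ps c) = list_comb (map to_complex ps) (\<lambda>i. of_rat (c i))"
  by (rule poly_mapping_eqI) (simp add: lookup_list_comb lookup_to_complex of_rat_sum of_rat_mult)

text \<open>Compared coefficient by coefficient, a complex relation solves a rational linear system
  with one equation per monomial \<open>m\<close>. It therefore splits into rational relations, all
  of which are trivial.\<close>

lemma list_independent_to_complex:
  "list_independent (map to_complex ps) \<longleftrightarrow> list_independent ps"
proof
  assume *: "list_independent (map to_complex ps)"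
  have "to_complex 0 = 0" by (rule poly_mapping_eqI) (simp add: lookup_to_complex)
  then show "list_independent ps"
    unfolding list_independent_def
    by (metis list_independentD[OF *] to_complex_list_comb length_map of_rat_eq_0_iff)
next
  assume *: "list_independent ps"
  show "list_independent (map to_complex ps)"
    unfolding list_independent_def
  proof (intro allI impI)
    fix c i assume c: "list_comb (map to_complex ps) c = 0" and i: "i < length (map to_complex ps)"
    have sol: "(\<Sum>j<length ps. c j * of_rat (Poly_Mapping.lookup (ps ! j) m)) = 0" for m
      using arg_cong[OF c, of "\<lambda>p. Poly_Mapping.lookup p m"]
      by (simp add: lookup_list_comb lookup_to_complex)
    obtain B and q :: "complex \<Rightarrow> nat \<Rightarrow> rat"
      where q: "\<forall>j<length ps. c j = (\<Sum>b\<in>B. of_rat (q b j) * b)"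
      "\<forall>b\<in>B. \<forall>m. (\<Sum>j<length ps. q b j * Poly_Mapping.lookup (ps ! j) m) = 0"
      using complex_solution_decomposition[where u = "\<lambda>m j. Poly_Mapping.lookup (ps ! j) m", OF sol] .
    have "list_comb ps (q b) = 0" if "b \<in> B" for b
      by (rule poly_mapping_eqI) (simp add: lookup_list_comb q(2)[rule_format, OF that])
    then have "q b i = 0" if "b \<in> B" for b
      using list_independentD[OF *] i that by simp
    then show "c i = 0" using q(1) i by simp
  qed
qed

text \<open>The detour over \<complex> replaces a permutation of indices:
  \<open>mpoly_independent\<close> depends only on the set of entries and on their
  distinctness.\<close>

lemma list_independent_mset_cong:
  fixes ps qs :: "('v, rat) mpoly list"
  assumes "mset ps = mset qs" "list_independent ps"
  shows "list_independent qs"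
proof -
  have "mset (map to_complex ps) = mset (map to_complex qs)" using assms(1) by simp
  then have "mpoly_independent (map to_complex ps) \<longleftrightarrow> mpoly_independent (map to_complex qs)"
    unfolding mpoly_independent_def using mset_eq_setD mset_eq_imp_distinct_iff by metis
  then show ?thesis
    using assms(2) by (simp add: mpoly_independent_iff list_independent_to_complex)
qed

section \<open>Bases of kernels of rational matrices\<close>

context
  fixes vb :: "rat mat \<Rightarrow> rat vec list" and X :: "rat mat"
  assumes vb: "is_vector_basis vb"
begin

abbreviation kernel_row :: "nat \<Rightarrow> (nat \<Rightarrow> rat) \<Rightarrow> rat" where
  "kernel_row i v \<equiv> \<Sum>j<dim_col X. X $$ (i, j) * v j"

lemma mat_kernel_iff:
  "v \<in> mat_kernel X \<longleftrightarrow> v \<in> carrier_vec (dim_col X) \<and> (\<forall>i<dim_row X. kernel_row i (($) v) = 0)"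
proof -
  have "(X *\<^sub>v v) $ i = kernel_row i (($) v)" if "i < dim_row X" "v \<in> carrier_vec (dim_col X)" for i
    using that by (auto simp: scalar_prod_def atLeast0LessThan intro!: sum.cong)
  then show ?thesis unfolding mat_kernel_def by (auto simp: vec_eq_iff)
qed

interpretation K: kernel "dim_row X" "dim_col X" X
  by unfold_locales simp

lemma vector_basis_kernel:
  shows "set (vb X) \<subseteq> mat_kernel X"
    and "\<forall>i<dim_row X. kernel_row i v = 0 \<Longrightarrow>
      \<exists>d. \<forall>j<dim_col X. v j = (\<Sum>k<length (vb X). d k * vb X ! k $ j)"
    and "\<forall>j<dim_col X. (\<Sum>k<length (vb X). d k * vb X ! k $ j) = 0 \<Longrightarrow> k < length (vb X) \<Longrightarrow> d k = 0"
proof -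
  let ?bs = "vb X"
  have dist: "distinct ?bs" and basis: "K.basis (set ?bs)"
    using vb unfolding is_vector_basis_def by auto
  from basis have sub: "set ?bs \<subseteq> mat_kernel X" and indep: "\<not> K.lin_dep (set ?bs)"
    and gen: "K.span (set ?bs) = mat_kernel X"
    unfolding K.Ker.basis_def by auto
  show "set ?bs \<subseteq> mat_kernel X" by fact
  have idx: "K.lincomb a (set ?bs) $ j = (\<Sum>k<length ?bs. a (?bs ! k) * ?bs ! k $ j)"
    if "j < dim_col X" for a j
    unfolding K.lincomb_index[OF that sub]
    by (rule sum.reindex_bij_betw[OF bij_betw_nth[OF dist refl refl], symmetric])
  {
    assume "\<forall>i<dim_row X. kernel_row i v = 0"
    then have "vec (dim_col X) v \<in> K.span (set ?bs)"
      unfolding gen mat_kernel_iff by simp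
    then obtain a where "vec (dim_col X) v = K.lincomb a (set ?bs)"
      using K.Ker.finite_in_span[OF finite_set sub] by metis
    then have "v j = (\<Sum>k<length ?bs. a (?bs ! k) * ?bs ! k $ j)" if "j < dim_col X" for j
      using idx[OF that, of a] that by (metis index_vec)
    then show "\<exists>d. \<forall>j<dim_col X. v j = (\<Sum>k<length ?bs. d k * ?bs ! k $ j)"
      by (intro exI[of _ "\<lambda>k. a (?bs ! k)"]) simp
  }
  {
    assume d: "\<forall>j<dim_col X. (\<Sum>k<length ?bs. d k * ?bs ! k $ j) = 0" and k: "k < length ?bs"
    obtain a where a: "\<forall>k<length ?bs. a (?bs ! k) = d k" using distinct_nth_factor[OF dist] by blast
    have "K.lincomb a (set ?bs) = 0\<^sub>v (dim_col X)"
    proof (rule eq_vecI)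
      have "K.lincomb a (set ?bs) \<in> mat_kernel X" using K.Ker.lincomb_closed[OF sub] by simp
      then show "dim_vec (K.lincomb a (set ?bs)) = dim_vec (0\<^sub>v (dim_col X))"
        unfolding mat_kernel_iff by simp
    qed (use idx d a in simp)
    then have "\<forall>v\<in>set ?bs. a v = 0"
      using indep unfolding K.Ker.lin_dep_def by blast
    then show "d k = 0" using a k by auto
  }
qed

text \<open>Serves both linear systems of the algorithm. A combination of \<open>Bs\<close> is the
  combination of \<open>ps\<close> whose coefficient vector is combined in the same way from the
  kernel basis, so spanning carries over from vectors to polynomials, and so does independence when
  \<open>ps\<close> is independent.\<close>

lemma kernel_list_comb:
  fixes ps :: "('v, rat) mpoly list"
  assumes ps: "length ps = dim_col X"
  defines "Bs \<equiv> map (lin_comb ps) (vb X)"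
  shows "P \<in> set Bs \<Longrightarrow> \<exists>c. P = list_comb ps c \<and> (\<forall>i<dim_row X. kernel_row i c = 0)"
    and "\<forall>i<dim_row X. kernel_row i c = 0 \<Longrightarrow> list_comb ps c \<in> list_span Bs"
    and "list_independent ps \<Longrightarrow> list_independent Bs"
proof -
  let ?bs = "vb X"
  have comb: "list_comb Bs d = list_comb ps (\<lambda>j. \<Sum>k<length ?bs. d k * ?bs ! k $ j)" for d
  proof (rule poly_mapping_eqI)
    fix m
    have "Poly_Mapping.lookup (list_comb Bs d) m =
        (\<Sum>k<length ?bs. \<Sum>j<length ps. d k * ?bs ! k $ j * Poly_Mapping.lookup (ps ! j) m)"
      by (simp add: Bs_def lookup_list_comb lin_comb_eq_list_comb sum_distrib_left mult.assoc)
    also have "\<dots> = (\<Sum>j<length ps. \<Sum>k<length ?bs. d k * ?bs ! k $ j * Poly_Mapping.lookup (ps ! j) m)"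
      by (rule sum.swap)
    also have "\<dots> = Poly_Mapping.lookup (list_comb ps (\<lambda>j. \<Sum>k<length ?bs. d k * ?bs ! k $ j)) m"
      by (simp add: lookup_list_comb sum_distrib_right)
    finally show "Poly_Mapping.lookup (list_comb Bs d) m =
        Poly_Mapping.lookup (list_comb ps (\<lambda>j. \<Sum>k<length ?bs. d k * ?bs ! k $ j)) m" .
  qed
  show "\<exists>c. P = list_comb ps c \<and> (\<forall>i<dim_row X. kernel_row i c = 0)" if "P \<in> set Bs"
    using that vector_basis_kernel(1)
    unfolding Bs_def lin_comb_eq_list_comb mat_kernel_iff[abs_def] subset_iff by (auto simp: mat_kernel_iff)
  show "list_comb ps c \<in> list_span Bs" if c: "\<forall>i<dim_row X. kernel_row i c = 0"
  proof -
    obtain d where "\<forall>j<dim_col X. c j = (\<Sum>k<length ?bs. d k * ?bs ! k $ j)"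
      using vector_basis_kernel(2)[OF c] by blast
    then have "list_comb ps c = list_comb Bs d" unfolding comb using ps by (intro list_comb_cong) simp
    then show ?thesis by (simp add: list_span_def)
  qed
  show "list_independent Bs" if "list_independent ps"
    unfolding list_independent_def
  proof (intro allI impI)
    fix d k assume "list_comb Bs d = 0" and k: "k < length Bs"
    then have "\<forall>j<dim_col X. (\<Sum>k<length ?bs. d k * ?bs ! k $ j) = 0"
      using list_independentD[OF that, of "\<lambda>j. \<Sum>k<length ?bs. d k * ?bs ! k $ j"] ps
      unfolding comb by simp
    then show "d k = 0" using vector_basis_kernel(3)[of d k] k by (simp add: Bs_def)
  qed
qed

end

section \<open>Termination of \<open>invariant_set\<close>\<close>

primrec adjoin_list :: "'a::comm_ring_1 set \<Rightarrow> 'a list \<Rightarrow> 'a set" where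
  "adjoin_list R [] = R"
| "adjoin_list R (x # xs) = adjoin (adjoin_list R xs) x"

lemma adjoin_list_subring: "is_subring R \<Longrightarrow> is_subring (adjoin_list R xs)"
  by (induction xs) (auto intro: adjoin_is_subring)

lemma adjoin_list_noetherian: "is_subring R \<Longrightarrow> noetherian R \<Longrightarrow> noetherian (adjoin_list R xs)"
  by (induction xs) (auto intro: noetherian_adjoin adjoin_list_subring)

lemma adjoin_list_base: "is_subring R \<Longrightarrow> r \<in> R \<Longrightarrow> r \<in> adjoin_list R xs"
  by (induction xs) (auto intro: adjoin_base adjoin_list_subring)

lemma adjoin_list_var: "is_subring R \<Longrightarrow> x \<in> set xs \<Longrightarrow> x \<in> adjoin_list R xs"
  by (induction xs) (auto intro: adjoin_base adjoin_var adjoin_list_subring)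

text \<open>Hilbert's basis theorem in the form needed: the type \<open>'v\<close> may be infinite,
  and \<open>R\<close> plays the role of the polynomial ring in the variables
  \<open>V\<close>.\<close>

lemma finite_variables_noetherian:
  fixes V :: "'v set"
  assumes "finite V"
  obtains R :: "('v, 'a::field) mpoly set"
  where "is_subring R" "noetherian R" "range Const \<subseteq> R" "Var ` V \<subseteq> R"
proof -
  let ?C = "range (Const :: 'a \<Rightarrow> ('v, 'a) mpoly)"
  have C: "is_subring ?C"
    unfolding is_subring_def
    by (auto simp flip: Const.hom_minus Const.hom_mult Const.hom_one)
  have "noetherian ?C"
    by (rule noetherian_field_image[OF _ _ C]) (auto simp flip: Const.hom_mult)
  moreover obtain xs where "set xs = V" using assms finite_list by blast
  ultimately show ?thesis
    by (intro that[of "adjoin_list ?C (map Var xs)"] adjoin_list_subring adjoin_list_noetherian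
        subsetI adjoin_list_base[OF C] adjoin_list_var[OF C] C) auto
qed

lemma subst_in_subring:
  assumes "is_subring R" "\<And>c. Const c \<in> R" "\<And>v. f v \<in> R"
  shows "subst f p \<in> R"
  unfolding subst_def eval_via_def
  by (intro is_subring_sum is_subring_mult is_subring_prod is_subring_power assms)

section \<open>Radicals, zeros and orbits\<close>

lemma times_module: "Modules.module ((*) :: 'a::comm_ring_1 \<Rightarrow> 'a \<Rightarrow> 'a)"
  by unfold_locales (auto simp: algebra_simps)

lemma eval_radical_eq_0:
  fixes x :: "'v \<Rightarrow> 'a::field"
  assumes "p \<in> radical (ideal_gen S)" "\<And>s. s \<in> S \<Longrightarrow> eval x s = 0"
  shows "eval x p = 0"
proof -
  interpret times: Modules.module "(*) :: ('v, 'a) mpoly \<Rightarrow> _" by (rule times_module)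
  have "eval x s = 0" if "s \<in> ideal_gen S" for s
    using that unfolding ideal_gen_def
    by (rule times.span_induct) (auto intro!: times.subspaceI simp: assms(2) eval.hom_add eval.hom_mult)
  then obtain k where "eval x p ^ k = 0"
    using assms(1) unfolding radical_def by (auto simp flip: eval.hom_power)
  then show ?thesis by simp
qed

lemma eval_subst_funpow:
  "eval x ((subst G ^^ i) p) = eval ((poly_map G ^^ i) x) p"
proof (induction i arbitrary: x)
  case (Suc i)
  have "eval x ((subst G ^^ Suc i) p) = eval (poly_map G x) ((subst G ^^ i) p)"
    by (simp add: eval_subst poly_map_def)
  then show ?case by (simp add: Suc funpow_swap1)
qed simp

text \<open>Once the next polynomial lies in the radical, a common zero of the polynomials found so far is
  mapped by \<open>G\<close> to another one, hence its whole orbit consists of zeros of \<open>p\<close>.\<close>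

lemma eval_all_iterates:
  fixes x :: "'v \<Rightarrow> 'a::field" and G :: "'v \<Rightarrow> ('v, 'a) mpoly"
  assumes "(subst G ^^ Suc N) p \<in> radical (ideal_gen ((\<lambda>i. (subst G ^^ i) p) ` {..N}))"
    and "\<And>i. i \<le> N \<Longrightarrow> eval x ((subst G ^^ i) p) = 0"
  shows "eval x ((subst G ^^ l) p) = 0"
proof -
  have "\<forall>i\<le>N. eval ((poly_map G ^^ l) x) ((subst G ^^ i) p) = 0"
  proof (induction l)
    case 0
    then show ?case using assms(2) by simp
  next
    case (Suc l)
    let ?y = "(poly_map G ^^ l) x"
    have "eval ?y ((subst G ^^ Suc N) p) = 0"
      by (rule eval_radical_eq_0[OF assms(1)]) (use Suc in auto)
    then have "eval ?y ((subst G ^^ Suc i) p) = 0" if "i \<le> N" for i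
      using Suc[rule_format, of "Suc i"] that by (cases "i = N") auto
    moreover have "eval ((poly_map G ^^ Suc l) x) q = eval ?y (subst G q)" for q
      by (simp add: eval_subst poly_map_def)
    ultimately show ?case by simp
  qed
  then have "eval ((poly_map G ^^ l) x) ((subst G ^^ 0) p) = 0" by blast
  then show ?thesis by (simp add: eval_subst_funpow)
qed

text \<open>The Noetherian property of \<open>R\<close> expresses some iterate through the earlier
  ones with coefficients in \<open>R\<close>, hence puts it in the ideal they generate in the full
  ring. The second conclusion is the negated loop condition, in the form
  \<open>eval_all_iterates\<close> expects.\<close>

lemma invariant_set_terminates:
  fixes p :: "('v, rat) mpoly" and G :: "'v \<Rightarrow> ('v, rat) mpoly"
  defines "q \<equiv> \<lambda>i. (subst G ^^ i) p"
  assumes R: "is_subring R" "noetherian R" "\<And>i. q i \<in> R"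
  obtains N where "invariant_set [p] G = Some (map (\<lambda>i. [q i]) [0..<Suc N])"
    and "q (Suc N) \<in> radical (ideal_gen (q ` {..N}))"
proof -
  interpret times: Modules.module "(*) :: ('v, rat) mpoly \<Rightarrow> _" by (rule times_module)
  define b where "b = (\<lambda>(S :: ('v, rat) mpoly list list, qs).
      \<not> set qs \<subseteq> radical (ideal_gen (\<Union>ps\<in>set S. set ps)))"
  define c where "c = (\<lambda>(S, qs). (S @ [qs], map (subst G) qs))"
  \<comment> \<open>After \<open>k\<close> steps \<open>q 0\<close> to \<open>q k\<close> are
    collected and \<open>q (Suc k)\<close> is waiting to be tested.\<close>
  have iter: "(c ^^ k) ([[p]], map (subst G) [p]) = (map (\<lambda>i. [q i]) [0..<Suc k], [q (Suc k)])" for k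
    by (induction k) (auto simp: c_def q_def)
  have b_iff: "\<not> b ((c ^^ k) ([[p]], map (subst G) [p])) \<longleftrightarrow> q (Suc k) \<in> radical (ideal_gen (q ` {..k}))" for k
  proof -
    have "(\<Union>ps\<in>set (map (\<lambda>i. [q i]) [0..<Suc k]). set ps) = q ` {..k}"
      by (auto simp: less_Suc_eq_le simp del: upt_Suc)
    then show ?thesis unfolding iter by (simp add: b_def del: upt_Suc)
  qed
  have radicalI: "s \<in> radical I" if "s \<in> I" for s :: "('v, rat) mpoly" and I
    using that unfolding radical_def by (auto intro: exI[of _ 1])
  have "\<exists>k. q (Suc k) \<in> radical (ideal_gen (q ` {..k}))"
  proof -
    from R obtain k r where k: "q k = (\<Sum>i<k. r i * q i)"
      unfolding noetherian_def seq_span_def by blast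
    show ?thesis
    proof (cases k)
      \<comment> \<open>Here \<open>q 0 = 0\<close>. The loop never tests \<open>q 0\<close> itself,
        but \<open>q 1\<close> is zero as well and stops it at once.\<close>
      case 0
      then have "q (Suc 0) = 0" using k by (simp add: q_def)
      then show ?thesis using radicalI[of 0] times.span_zero unfolding ideal_gen_def by metis
    next
      case (Suc n)
      have "q (Suc n) \<in> ideal_gen (q ` {..n})"
        unfolding ideal_gen_def k[unfolded Suc]
        by (intro times.span_sum times.span_scale times.span_base) auto
      then show ?thesis using radicalI by blast
    qed
  qed
  then have ex: "\<exists>k. \<not> b ((c ^^ k) ([[p]], map (subst G) [p]))" using b_iff by blast
  \<comment> \<open>The same \<open>LEAST\<close> as in \<open>while_option_def\<close>, so that the
    loop is unfolded to a single iterate.\<close>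
  define N where "N = (LEAST k. \<not> b ((c ^^ k) ([[p]], map (subst G) [p])))"
  have "\<not> b ((c ^^ N) ([[p]], map (subst G) [p]))" unfolding N_def using ex by (rule LeastI_ex)
  moreover have "while_option b c ([[p]], map (subst G) [p]) = Some ((c ^^ N) ([[p]], map (subst G) [p]))"
    unfolding while_option_def N_def using ex by (rule if_P)
  then have "invariant_set [p] G = Some (map (\<lambda>i. [q i]) [0..<Suc N])"
    unfolding invariant_set_def b_def[symmetric] c_def[symmetric] iter by simp
  ultimately show ?thesis using that b_iff by blast
qed

section \<open>Correctness of the algorithms\<close>

context
  fixes hs :: "('n::finite, rat) mpoly list" and F :: "'n \<Rightarrow> ('n, rat) mpoly"
begin

text \<open>The operator \<open>T\<close> of the overview. Substituting the extended map into
  \<open>z * q\<close> gives \<open>z * T q\<close>, because \<open>z\<close> is replaced by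
  \<open>z * h\<close>.\<close>

definition weighted_pullback :: "('n, rat) mpoly \<Rightarrow> ('n, rat) mpoly" where
  "weighted_pullback q = prod_list hs * subst F q"

abbreviation pullback_iter :: "nat \<Rightarrow> ('n, rat) mpoly \<Rightarrow> ('n, rat) mpoly" where
  "pullback_iter l \<equiv> weighted_pullback ^^ l"

lemma eval_pullback_iter:
  "eval a (pullback_iter l q) =
    (\<Prod>j<l. eval ((poly_map F ^^ j) a) (prod_list hs)) * eval ((poly_map F ^^ l) a) q"
proof (induction l arbitrary: a)
  case (Suc l)
  have "eval a (pullback_iter (Suc l) q) = eval a (prod_list hs) * eval (poly_map F a) (pullback_iter l q)"
    by (simp only: funpow.simps comp_apply weighted_pullback_def eval.hom_mult eval_subst poly_map_def)
  moreover have "(poly_map F ^^ j) (poly_map F a) = (poly_map F ^^ Suc j) a" for j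
    by (simp add: funpow_swap1)
  ultimately show ?case
    by (simp only: Suc.IH prod.lessThan_Suc_shift mult.assoc funpow_0)
qed simp

lemma pullback_iter_list_comb: "pullback_iter l (list_comb ps c) = list_comb (map (pullback_iter l) ps) c"
proof (induction l)
  case (Suc l)
  have "weighted_pullback (list_comb qs c) = list_comb (map weighted_pullback qs) c" for qs
    by (simp add: weighted_pullback_def list_comb_def subst.hom_sum subst.hom_mult
        sum_distrib_left mult_ac)
  then show ?case by (simp add: Suc comp_def)
qed (simp add: list_comb_def)

lemma eval_pullback_iter_list_comb:
  "eval a (pullback_iter l (list_comb ps c)) = (\<Sum>j<length ps. c j * eval a (pullback_iter l (ps ! j)))"
  by (simp add: pullback_iter_list_comb) (simp add: list_comb_def eval.hom_sum eval.hom_mult)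

text \<open>The right-hand side is a linear system with rational coefficients in complex unknowns
  \<open>c\<close>, as \<open>complex_solution_decomposition\<close> requires. At an index where the
  weight \<open>?w l\<close> is zero, the guard fails on the left and the equation is trivial on the
  right.\<close>

lemma loop_invariant_iff:
  "loop_invariant (\<lambda>i. of_rat (a i)) (map to_complex hs) (\<lambda>i. to_complex (F i))
      (list_comb (map to_complex gs) c) \<longleftrightarrow>
    (\<forall>l. (\<Sum>j<length gs. c j * of_rat (eval a (pullback_iter l (gs ! j)))) = 0)"
proof -
  let ?F = "poly_map (\<lambda>i. to_complex (F i))" and ?a = "\<lambda>i. of_rat (a i)"
  have orbit: "(?F ^^ j) ?a = (\<lambda>i. of_rat ((poly_map F ^^ j) a i))" for j
    by (induction j) (simp_all add: poly_map_def eval_to_complex)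
  let ?w = "\<lambda>l. \<Prod>j<l. eval ((poly_map F ^^ j) a) (prod_list hs)"
  have eval_prod_list: "eval x (prod_list hs) \<noteq> 0 \<longleftrightarrow> (\<forall>h\<in>set hs. eval x h \<noteq> 0)" for x
    by (induction hs) (auto simp: eval.hom_mult)
  have guard: "(\<forall>j<l. \<forall>h\<in>set (map to_complex hs). eval ((?F ^^ j) ?a) h \<noteq> 0) \<longleftrightarrow> ?w l \<noteq> 0" for l
    by (auto simp: orbit eval_to_complex eval_prod_list)
  let ?s = "\<lambda>l. \<Sum>j<length gs. c j * of_rat (eval ((poly_map F ^^ l) a) (gs ! j))"
  have eval_comb: "eval ((?F ^^ l) ?a) (list_comb (map to_complex gs) c) =
      ?s l" for l
    by (simp add: list_comb_def eval.hom_sum eval.hom_mult orbit eval_to_complex)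
  have weighted: "(\<Sum>j<length gs. c j * of_rat (eval a (pullback_iter l (gs ! j)))) =
      of_rat (?w l) * ?s l" for l
    unfolding eval_pullback_iter of_rat_mult sum_distrib_left
    by (intro sum.cong refl mult.left_commute)
  show ?thesis
    unfolding loop_invariant_def guard eval_comb weighted mult_eq_0_iff of_rat_eq_0_iff by blast
qed

lemma check_pi_correct:
  "\<exists>b. check_pi a P hs F = Some b \<and> (b \<longleftrightarrow> (\<forall>l. eval a (pullback_iter l P) = 0))"
proof -
  define lift where "lift = subst (\<lambda>i. Var (Some i) :: ('n option, rat) mpoly)"
  define G where "G = case_option (Var None * lift (prod_list hs)) (\<lambda>i. lift (F i))"
  have step: "subst G (Var None * lift q) = Var None * lift (weighted_pullback q)" for q
    by (simp add: G_def lift_def weighted_pullback_def subst.hom_mult subst_subst mult_ac)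
  have iter: "(subst G ^^ i) (Var None * lift P) = Var None * lift (pullback_iter i P)" for i
    by (induction i) (simp_all add: step)
  \<comment> \<open>The type \<open>'n option\<close> is finite, so here \<open>R\<close> can
    contain every variable.\<close>
  obtain R :: "('n option, rat) mpoly set" where R: "is_subring R" "noetherian R"
    "range Const \<subseteq> R" "Var ` UNIV \<subseteq> R"
    using finite_variables_noetherian[OF finite_UNIV] by blast
  have "(subst G ^^ i) (Var None * lift P) \<in> R" for i
    unfolding iter unfolding lift_def using R by (intro is_subring_mult subst_in_subring) auto
  then obtain N where N: "invariant_set [Var None * lift P] G =
      Some (map (\<lambda>i. [(subst G ^^ i) (Var None * lift P)]) [0..<Suc N])"
    and rad: "(subst G ^^ Suc N) (Var None * lift P) \<in>
      radical (ideal_gen ((\<lambda>i. (subst G ^^ i) (Var None * lift P)) ` {..N}))"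
    using invariant_set_terminates[OF R(1,2)] by blast
  let ?x = "case_option 1 a"
  have eval: "eval ?x ((subst G ^^ i) (Var None * lift P)) = eval a (pullback_iter i P)" for i
    unfolding iter unfolding lift_def by (simp add: eval.hom_mult eval_subst)
  have "check_pi a P hs F = Some (\<forall>i\<le>N. eval ?x ((subst G ^^ i) (Var None * lift P)) = 0)"
    unfolding check_pi_def Let_def lift_def[symmetric] G_def[symmetric] N
    by (auto simp: less_Suc_eq_le simp del: upt_Suc)
  moreover have "(\<forall>i\<le>N. eval ?x ((subst G ^^ i) (Var None * lift P)) = 0) \<longleftrightarrow>
      (\<forall>l. eval a (pullback_iter l P) = 0)"
    using eval_all_iterates[OF rad, of ?x] unfolding eval by blast
  ultimately show ?thesis by blast
qed

section \<open>Generic linear combinations and their matrix\<close>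

lemma subst_lift_x: "subst f (lift_x p) = subst (\<lambda>i. f (X_var i)) p"
  by (simp add: lift_x_def subst_subst)

lemma subst_ext_map_generic_comb:
  "subst (ext_map hs F) (generic_comb qs) = generic_comb (map weighted_pullback qs)"
proof -
  have "subst (ext_map hs F) (lift_x p) = lift_x (subst F p)" for p
    unfolding subst_lift_x by (simp add: ext_map_def lift_x_def subst_subst)
  moreover have "lift_x (p * q) = lift_x p * lift_x q" for p q :: "('n, rat) mpoly"
    by (simp add: lift_x_def subst.hom_mult)
  ultimately show ?thesis
    by (simp add: generic_comb_def subst.hom_mult subst.hom_sum weighted_pullback_def)
      (simp add: ext_map_def sum_distrib_left mult_ac)
qed

lemma subst_ext_map_funpow_generic_comb:
  "(subst (ext_map hs F) ^^ i) (generic_comb qs) = generic_comb (map (pullback_iter i) qs)"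
  by (induction i) (simp_all add: subst_ext_map_generic_comb comp_def)

lemma set_z_1_generic_comb:
  fixes qs :: "('n, rat) mpoly list"
  shows "set_z_1 (generic_comb qs) = (\<Sum>j<length qs. lift_x (qs ! j) * Var (Y_var j))"
  unfolding set_z_1_def generic_comb_def
  by (simp add: subst.hom_mult subst.hom_sum subst_lift_x mult.commute flip: lift_x_def)

text \<open>Setting \<open>y_k\<close> to 1 and the other \<open>y_j\<close> to 0 reads off the
  \<open>k\<close>-th coefficient. This gives the uniqueness behind the \<open>THE\<close> in
  \<open>compute_matrix\<close>.\<close>

lemma lift_x_forms_inject:
  fixes p q :: "nat \<Rightarrow> ('n, rat) mpoly"
  assumes "(\<Sum>j<m. lift_x (p j) * Var (Y_var j)) = (\<Sum>j<m. lift_x (q j) * Var (Y_var j))"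
    and "k < m"
  shows "p k = q k"
proof -
  let ?f = "\<lambda>v. case v of X_var i \<Rightarrow> Var i | Y_var j \<Rightarrow> if j = k then 1 else 0 | Z_var \<Rightarrow> 1"
  have "subst ?f (\<Sum>j<m. lift_x (r j) * Var (Y_var j)) = r k" for r :: "nat \<Rightarrow> ('n, rat) mpoly"
  proof -
    have "subst ?f (\<Sum>j<m. lift_x (r j) * Var (Y_var j)) = (\<Sum>j<m. if j = k then r j else 0)"
      unfolding subst.hom_sum
      by (intro sum.cong) (auto simp: subst.hom_mult subst_lift_x subst_Var_id)
    then show ?thesis using assms(2) by simp
  qed
  from this[of p] this[of q] show ?thesis unfolding assms(1) by (rule trans[OF sym])
qed

lemma compute_matrix_correct:
  obtains A where "compute_matrix gs hs F = Some A" "dim_col A = length gs"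
    and "\<forall>c. (\<forall>i<dim_row A. (\<Sum>j<length gs. eval a (A $$ (i, j)) * c j) = 0) \<longleftrightarrow>
      (\<forall>l. eval a (pullback_iter l (list_comb gs c)) = 0)"
proof -
  let ?m = "length gs" and ?G = "ext_map hs F"
  let ?q = "\<lambda>i. (subst ?G ^^ i) (generic_comb gs)"
  \<comment> \<open>Only these variables occur in the iterates; the infinitely many remaining
    \<open>Y_var j\<close> must stay outside \<open>R\<close>.\<close>
  let ?V = "insert Z_var (range (X_var :: 'n \<Rightarrow> _) \<union> Y_var ` {..<?m})"
  have "finite ?V" by simp
  then obtain R :: "('n xyz, rat) mpoly set" where R: "is_subring R" "noetherian R"
    "range Const \<subseteq> R" "Var ` ?V \<subseteq> R"
    using finite_variables_noetherian by blast
  have "?q i \<in> R" for i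
    unfolding subst_ext_map_funpow_generic_comb unfolding generic_comb_def lift_x_def using R
    by (intro is_subring_mult is_subring_sum subst_in_subring) auto
  then obtain N where N: "invariant_set [generic_comb gs] ?G = Some (map (\<lambda>i. [?q i]) [0..<Suc N])"
    and rad: "?q (Suc N) \<in> radical (ideal_gen (?q ` {..N}))"
    using invariant_set_terminates[OF R(1,2)] by blast
  define A where "A = mat (Suc N) ?m (\<lambda>(i, j). pullback_iter i (gs ! j))"
  have concat: "concat (map (\<lambda>i. [?q i]) [0..<Suc N]) = map ?q [0..<Suc N]"
    by (induction "[0..<Suc N]") (simp_all del: upt_Suc add: concat_map_singleton)
  have form: "set_z_1 (?q i) = (\<Sum>j<?m. lift_x (pullback_iter i (gs ! j)) * Var (Y_var j))" for i
    by (simp add: subst_ext_map_funpow_generic_comb set_z_1_generic_comb)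
  have "(THE A'. A' \<in> carrier_mat (Suc N) ?m \<and>
      (\<forall>i<Suc N. set_z_1 (?q i) = (\<Sum>j<?m. lift_x (A' $$ (i, j)) * Var (Y_var j)))) = A"
  proof (rule the_equality)
    show "A \<in> carrier_mat (Suc N) ?m \<and>
      (\<forall>i<Suc N. set_z_1 (?q i) = (\<Sum>j<?m. lift_x (A $$ (i, j)) * Var (Y_var j)))"
      unfolding form by (simp add: A_def)
    fix A' assume *: "A' \<in> carrier_mat (Suc N) ?m \<and>
      (\<forall>i<Suc N. set_z_1 (?q i) = (\<Sum>j<?m. lift_x (A' $$ (i, j)) * Var (Y_var j)))"
    then have "pullback_iter i (gs ! j) = A' $$ (i, j)" if "i < Suc N" "j < ?m" for i j
      using that unfolding form by (intro lift_x_forms_inject[of _ ?m]) auto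
    with * show "A' = A" by (intro eq_matI) (auto simp: A_def)
  qed
  then have "compute_matrix gs hs F = Some A"
    unfolding compute_matrix_def N Let_def concat option.map option.sel by (simp del: upt_Suc cong: conj_cong)
  moreover have "(\<forall>i<dim_row A. (\<Sum>j<?m. eval a (A $$ (i, j)) * c j) = 0) \<longleftrightarrow>
      (\<forall>l. eval a (pullback_iter l (list_comb gs c)) = 0)" for c
  proof -
    \<comment> \<open>The vector \<open>c\<close> enters as the value of the
      \<open>y\<close>-variables. Hence one \<open>N\<close>, found before \<open>c\<close> is
      fixed, serves all coefficient vectors.\<close>
    let ?x = "\<lambda>v. case v of X_var i \<Rightarrow> a i | Y_var j \<Rightarrow> c j | Z_var \<Rightarrow> 1"
    have eval: "eval ?x (?q i) = (\<Sum>j<?m. eval a (pullback_iter i (gs ! j)) * c j)" for i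
      unfolding subst_ext_map_funpow_generic_comb
      by (simp add: generic_comb_def lift_x_def eval.hom_mult eval.hom_sum eval_subst mult.commute)
    have "(\<forall>i<dim_row A. (\<Sum>j<?m. eval a (A $$ (i, j)) * c j) = 0) \<longleftrightarrow> (\<forall>i\<le>N. eval ?x (?q i) = 0)"
      unfolding eval by (auto simp: A_def less_Suc_eq_le)
    also have "\<dots> \<longleftrightarrow> (\<forall>l. eval ?x (?q l) = 0)"
      using eval_all_iterates[OF rad, of ?x] by blast
    finally show ?thesis unfolding eval eval_pullback_iter_list_comb by (simp add: mult.commute)
  qed
  ultimately show ?thesis using that by (simp add: A_def)
qed

text \<open>The algorithm moves the point while the other lemmas pull back the polynomial;
  \<open>subst_subst\<close> exchanges the two. The coefficient of \<open>y_j\<close> in the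
  \<open>i\<close>-th form is then the value at \<open>a\<close> of the \<open>i\<close>-th iterate
  of \<open>gs ! j\<close>.\<close>

lemma linear_forms_mat_correct:
  fixes a :: "'n \<Rightarrow> rat" and gs :: "('n, rat) mpoly list"
  defines "pt \<equiv> \<lambda>v. case v of X_var i \<Rightarrow> Const (a i) | Y_var j \<Rightarrow> Var j | Z_var \<Rightarrow> 1"
  defines "form \<equiv> \<lambda>i. subst (((\<lambda>q v. subst q (ext_map hs F v)) ^^ i) pt) (generic_comb gs)"
  shows "linear_forms_mat (length gs) (map form [0..<k]) =
    mat k (length gs) (\<lambda>(i, j). eval a (pullback_iter i (gs ! j)))"
proof -
  have iter: "subst (((\<lambda>q v. subst q (ext_map hs F v)) ^^ i) f) p =
      subst f ((subst (ext_map hs F) ^^ i) p)" for i p and f :: "'n xyz \<Rightarrow> (nat, rat) mpoly"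
  proof (induction i arbitrary: p)
    case (Suc i)
    have "subst (((\<lambda>q v. subst q (ext_map hs F v)) ^^ Suc i) f) p =
        subst (((\<lambda>q v. subst q (ext_map hs F v)) ^^ i) f) (subst (ext_map hs F) p)"
      by (simp add: subst_subst)
    then show ?case by (simp only: Suc.IH funpow_Suc_right comp_apply)
  qed simp
  have "form i = (\<Sum>j<length gs. Const (eval a (pullback_iter i (gs ! j))) * Var j)" for i
    unfolding form_def iter subst_ext_map_funpow_generic_comb unfolding generic_comb_def
    by (simp add: subst.hom_mult subst.hom_sum subst_lift_x pt_def subst_Const_point mult.commute)
  moreover have "Poly_Mapping.lookup (Var l) (Poly_Mapping.single j 1) = (if l = j then 1 else (0::rat))"
    for l j :: nat
  proof -
    have "l = j" if "Poly_Mapping.single l (1::nat) = Poly_Mapping.single j 1"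
      using arg_cong[OF that, of Poly_Mapping.keys] by simp
    then show ?thesis by (auto simp: Var_def lookup_single when_def)
  qed
  ultimately show ?thesis
    unfolding linear_forms_mat_def
    by (intro eq_matI) (auto simp: lookup_sum lookup_Const_mult if_distrib[of "\<lambda>x. _ * x"]
        cong: if_cong)
qed

text \<open>The rows of \<open>M\<close> are necessary conditions, so the span of \<open>Bs\<close>
  contains every rational invariant in the span of \<open>gs\<close>. When a combination of
  \<open>B' @ B''\<close> is invariant, its \<open>B''\<close> part is invariant by itself; hence so
  is its \<open>B'\<close> part, which lies in the span of \<open>C\<close>.\<close>

lemma truncated_ideal_correct:
  assumes vb: "is_vector_basis vb"
  obtains out where "truncated_ideal vb a gs hs F = Some out"
    and "set out \<subseteq> list_span gs"
    and "\<forall>P\<in>set out. \<forall>l. eval a (pullback_iter l P) = 0"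
    and "\<forall>c. (\<forall>l. eval a (pullback_iter l (list_comb gs c)) = 0) \<longrightarrow> list_comb gs c \<in> list_span out"
    and "list_independent gs \<longrightarrow> list_independent out"
proof -
  let ?m = "length gs"
  define vanishes where "vanishes P \<longleftrightarrow> (\<forall>l. eval a (pullback_iter l P) = 0)" for P
  define M where "M = mat (?m + 1) ?m (\<lambda>(i, j). eval a (pullback_iter i (gs ! j)))"
  define Bs where "Bs = map (lin_comb gs) (vb M)"
  have M: "?m = dim_col M" by (simp add: M_def)
  note Bs_kernel = kernel_list_comb[OF vb M, folded Bs_def]
  have Bs_span: "set Bs \<subseteq> list_span gs"
    using Bs_kernel(1) unfolding list_span_def by blast
  have span_Bs: "list_comb gs c \<in> list_span Bs" if "vanishes (list_comb gs c)" for c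
    using that by (intro Bs_kernel(2))
      (auto simp: M_def vanishes_def eval_pullback_iter_list_comb mult.commute)
  have check: "check_pi a P hs F = Some (vanishes P)" for P
    using check_pi_correct[of a P] unfolding vanishes_def by metis
  define B' where "B' = filter (\<lambda>P. \<not> vanishes P) Bs"
  define B'' where "B'' = filter vanishes Bs"
  \<comment> \<open>Removal by membership agrees with filtering, since equal polynomials get the
    same verdict from \<open>check_pi\<close>.\<close>
  have B''_eq: "filter (\<lambda>P. P \<notin> set B') Bs = B''"
    unfolding B''_def B'_def by (intro filter_cong) auto
  have mset: "mset Bs = mset (B' @ B'')"
    unfolding B'_def B''_def mset_append mset_filter
    by (subst add.commute) (rule multiset_partition)
  obtain A where A: "compute_matrix B' hs F = Some A" "dim_col A = length B'"
    and A_iff: "\<forall>c. (\<forall>i<dim_row A. (\<Sum>j<length B'. eval a (A $$ (i, j)) * c j) = 0) \<longleftrightarrow>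
      vanishes (list_comb B' c)"
    unfolding vanishes_def using compute_matrix_correct[where gs = B' and a = a] .
  have result: "truncated_ideal vb a gs hs F =
     (if B' = [] then Some Bs else Some (map (lin_comb B') (vb (map_mat (eval a) A)) @ B''))"
    unfolding truncated_ideal_def Let_def linear_forms_mat_correct M_def[symmetric] Bs_def[symmetric]
      check by (simp add: B'_def[symmetric] A(1) B''_eq)
  show ?thesis
  proof (cases "B' = []")
    case True
    then have "\<forall>P\<in>set Bs. vanishes P" by (auto simp: B'_def filter_empty_conv)
    then show ?thesis
      using that[of Bs] result True Bs_span span_Bs Bs_kernel(3) unfolding vanishes_def by auto
  next
    case False
    define C where "C = map (lin_comb B') (vb (map_mat (eval a) A))"
    have dims: "length B' = dim_col (map_mat (eval a) A)" using A(2) by simp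
    note C_kernel = kernel_list_comb[OF vb dims, folded C_def]
    have kernel_iff: "(\<forall>i<dim_row (map_mat (eval a) A).
        (\<Sum>j<dim_col (map_mat (eval a) A). map_mat (eval a) A $$ (i, j) * c j) = 0) \<longleftrightarrow>
        vanishes (list_comb B' c)" for c
      unfolding A_iff[rule_format, symmetric] using A(2) by simp
    have C: "vanishes P \<and> P \<in> list_span B'" if "P \<in> set C" for P
      using C_kernel(1)[OF that] unfolding kernel_iff list_span_def by blast
    have span_C: "list_comb B' c \<in> list_span C" if "vanishes (list_comb B' c)" for c
      using C_kernel(2)[of c] that unfolding kernel_iff by blast
    have vanishes_diff: "vanishes P" if "vanishes (P + Q)" "vanishes Q" for P Q
    proof -
      \<comment> \<open>Subtraction is written as a two-term combination in order to use the
        linearity in \<open>eval_pullback_iter_list_comb\<close>.\<close>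
      have "P = list_comb [P + Q, Q] (\<lambda>i. if i = 0 then 1 else -1)"
        by (simp add: list_comb_def Const.hom_uminus)
      then have "eval a (pullback_iter l P) =
          eval a (pullback_iter l (P + Q)) - eval a (pullback_iter l Q)" for l
        using eval_pullback_iter_list_comb[of a l "[P + Q, Q]" "\<lambda>i. if i = 0 then 1 else -1"] by simp
      then show ?thesis using that by (simp add: vanishes_def)
    qed
    have vanishes_B'': "vanishes (list_comb B'' c)" for c
      unfolding vanishes_def eval_pullback_iter_list_comb
    proof (intro allI sum.neutral ballI)
      fix l j assume "j \<in> {..<length B''}"
      then have "B'' ! j \<in> set B''" by simp
      then show "c j * eval a (pullback_iter l (B'' ! j)) = 0" by (simp add: B''_def vanishes_def)
    qed
    show ?thesis
    proof (rule that[of "C @ B''"])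
      show "truncated_ideal vb a gs hs F = Some (C @ B'')" using result False by (simp add: C_def)
      have "list_span B' \<subseteq> list_span gs"
        using Bs_span by (intro list_span_minimal) (auto simp: B'_def)
      then show "set (C @ B'') \<subseteq> list_span gs" using C Bs_span by (auto simp: B''_def)
      show "\<forall>P\<in>set (C @ B''). \<forall>l. eval a (pullback_iter l P) = 0"
        using C by (auto simp: B''_def vanishes_def)
      have "list_comb gs c \<in> list_span (C @ B'')" if v: "vanishes (list_comb gs c)" for c
      proof -
        have "list_span Bs \<subseteq> list_span (B' @ B'')"
          using mset_eq_setD[OF mset] by (intro list_span_mono) simp
        then obtain d where d: "list_comb gs c = list_comb (B' @ B'') d"
          using span_Bs[OF v] unfolding list_span_def by blast
        let ?d = "\<lambda>i. d (length B' + i)"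
        have "vanishes (list_comb B' d)"
          using v vanishes_diff[OF _ vanishes_B''] unfolding d list_comb_append by blast
        then have "list_comb B' d \<in> list_span (C @ B'')"
          using span_C list_span_mono[of C "C @ B''"] by auto
        moreover have "list_comb B'' ?d \<in> list_span (C @ B'')"
          using list_span_mono[of B'' "C @ B''"] by (auto simp: list_span_def)
        ultimately show ?thesis unfolding d list_comb_append by (rule list_span_add)
      qed
      then show "\<forall>c. (\<forall>l. eval a (pullback_iter l (list_comb gs c)) = 0) \<longrightarrow>
          list_comb gs c \<in> list_span (C @ B'')"
        by (simp add: vanishes_def)
      show "list_independent gs \<longrightarrow> list_independent (C @ B'')"
      proof
        assume "list_independent gs"
        then have B: "list_independent (B' @ B'')"
          using Bs_kernel(3) list_independent_mset_cong[OF mset] by blast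
        from list_independent_appendD[OF B] have "list_independent C" by (rule C_kernel(3))
        moreover have "set C \<subseteq> list_span B'" using C by blast
        ultimately show "list_independent (C @ B'')" using list_independent_append_replace[OF B] by metis
      qed
    qed
  qed
qed

end

text \<open>The basis claim is conditional because a linear relation among the \<open>gs\<close>
  satisfies every linear condition on coefficient vectors. It then reappears as a relation in the
  output list, which still spans the right space.\<close>

theorem theorem4p7:
  fixes a :: "'n::finite \<Rightarrow> rat"
    and gs hs :: "('n, rat) mpoly list"
    and F :: "'n \<Rightarrow> ('n, rat) mpoly"
    and vb :: "rat mat \<Rightarrow> rat vec list"
  defines "E \<equiv> mpoly_span (set (map to_complex gs))"
  defines "I \<equiv> invariants_in (\<lambda>i. of_rat (a i)) (map to_complex hs) (\<lambda>i. to_complex (F i)) E"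
  assumes "is_vector_basis vb"
  shows "\<exists>out. truncated_ideal vb a gs hs F = Some out \<and>
    mpoly_span (set (map to_complex out)) = I \<and>
    (mpoly_independent (map to_complex gs) \<longrightarrow> mpoly_basis (map to_complex out) I)"
proof -
  let ?it = "pullback_iter hs F" and ?gs = "map to_complex gs"
  let ?inv = "loop_invariant (\<lambda>i. of_rat (a i)) (map to_complex hs) (\<lambda>i. to_complex (F i))"
  obtain out where out: "truncated_ideal vb a gs hs F = Some out" "set out \<subseteq> list_span gs"
    "\<forall>P\<in>set out. \<forall>l. eval a (?it l P) = 0"
    "\<forall>c. (\<forall>l. eval a (?it l (list_comb gs c)) = 0) \<longrightarrow> list_comb gs c \<in> list_span out"
    "list_independent gs \<longrightarrow> list_independent out"
    using truncated_ideal_correct[OF assms(3)] .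
  let ?out = "map to_complex out"
  have to_complex_span: "to_complex p \<in> list_span (map to_complex ps)" if "p \<in> list_span ps" for p ps
    using that unfolding list_span_def by (auto simp: to_complex_list_comb)
  have "list_span ?out = I"
  proof
    show "list_span ?out \<subseteq> I"
    proof
      fix P assume "P \<in> list_span ?out"
      then obtain c where c: "P = list_comb ?out c" by (auto simp: list_span_def)
      have "list_span ?out \<subseteq> list_span ?gs"
        using out(2) to_complex_span by (intro list_span_minimal) auto
      \<comment> \<open>\<open>loop_invariant_iff\<close> is used with \<open>out\<close> in place
        of \<open>gs\<close>, so that every term of each sum is zero.\<close>
      moreover have "?inv P"
        unfolding c loop_invariant_iff using out(3) by simp
      ultimately show "P \<in> I"
        using c unfolding I_def E_def invariants_in_def mpoly_span_set list_span_def by blast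
    qed
    show "I \<subseteq> list_span ?out"
    proof
      fix P assume "P \<in> I"
      then obtain c where c: "P = list_comb ?gs c" and "?inv P"
        unfolding I_def E_def invariants_in_def mpoly_span_set list_span_def by blast
      then have sol: "(\<Sum>j<length gs. c j * of_rat (eval a (?it l (gs ! j)))) = 0" for l
        unfolding c loop_invariant_iff by blast
      obtain B and q :: "complex \<Rightarrow> nat \<Rightarrow> rat"
        where B: "\<forall>j<length gs. c j = (\<Sum>b\<in>B. of_rat (q b j) * b)"
          "\<forall>b\<in>B. \<forall>l. (\<Sum>j<length gs. q b j * eval a (?it l (gs ! j))) = 0"
        using complex_solution_decomposition[where u = "\<lambda>l j. eval a (?it l (gs ! j))", OF sol] .
      \<comment> \<open>Each \<open>b\<close> contributes a rational combination that is itself an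
        invariant, so \<open>P\<close> is a complex combination of polynomials in the rational span
        of \<open>out\<close>.\<close>
      have "P = (\<Sum>b\<in>B. Const b * to_complex (list_comb gs (q b)))"
        unfolding c
      proof (rule poly_mapping_eqI)
        fix m
        let ?l = "\<lambda>j. of_rat (Poly_Mapping.lookup (gs ! j) m)"
        have "Poly_Mapping.lookup (list_comb ?gs c) m =
            (\<Sum>j<length gs. \<Sum>b\<in>B. b * (of_rat (q b j) * ?l j))"
          unfolding lookup_list_comb length_map
          by (intro sum.cong) (simp_all add: lookup_to_complex B(1) sum_distrib_left mult_ac)
        also have "\<dots> = (\<Sum>b\<in>B. \<Sum>j<length gs. b * (of_rat (q b j) * ?l j))"
          by (rule sum.swap)
        also have "\<dots> =
            Poly_Mapping.lookup (\<Sum>b\<in>B. Const b * to_complex (list_comb gs (q b))) m"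
          by (simp add: lookup_sum lookup_Const_mult lookup_to_complex lookup_list_comb of_rat_sum
              of_rat_mult sum_distrib_left)
        finally show "Poly_Mapping.lookup (list_comb ?gs c) m =
            Poly_Mapping.lookup (\<Sum>b\<in>B. Const b * to_complex (list_comb gs (q b))) m" .
      qed
      moreover have "list_comb gs (q b) \<in> list_span out" if "b \<in> B" for b
        using B(2) that by (intro out(4)[rule_format]) (simp add: eval_pullback_iter_list_comb)
      ultimately show "P \<in> list_span ?out"
        by (auto intro!: list_span_sum list_span_Const_mult to_complex_span)
    qed
  qed
  then show ?thesis
    using out(1,5) unfolding mpoly_basis_def mpoly_independent_iff list_independent_to_complex
      mpoly_span_set by blast
qed

end
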